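(* Let $\mathbb{J}$ be an invertible antisymmetric real $2k\times2k$ matrix and $d\ge1$. The left action of the generalized Jacobi group $\operatorname{Jac}(\mathbb{R}^{2k},\mathbb{J};\mathbb{R}^d)$ on the dual $\mathfrak{h}^*(\mathbb{R}^{2k},\mathbb{J};\mathbb{R}^d)$ of the generalized Heisenberg Lie algebra given by $$(g,\mathcal{A},\mathcal{B})\cdot(\mathcal{K},\mathcal{M})=\big(\mathcal{K}g^{-1}-\mathcal{M}\mathcal{A}^T\mathbb{J},\,\mathcal{M}\big)$$ is canonical with respect to the Lie--Poisson bracket on $\mathfrak{h}^*(\mathbb{R}^{2k},\mathbb{J};\mathbb{R}^d)$. Moreover, when restricted to the open subset $\widetilde{\mathfrak{h}}^*(\mathbb{R}^{2k},\mathbb{J};\mathbb{R}^d)=\{(\mathcal{K},\mathcal{M}):\det\mathcal{M}\ne0\}$ endowed with the plus (right) Lie--Poisson bracket, it admits the equivariant momentum map $$\Psi:\widetilde{\mathfrak{h}}^*_+(\mathbb{R}^{2k},\mathbb{J};\mathbb{R}^d)\to\mathfrak{jac}^*(\mathbb{R}^{2k},\mathbb{J};\mathbb{R}^d),\qquad(\mathcal{K},\mathcal{M})\mapsto\Big(\tfrac12\,\mathbb{J}^{-1}\mathcal{K}^T\mathcal{M}^{-1}\mathcal{K},\ \mathcal{K},\ \mathcal{M}\Big).$$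
   Context: $\mathcal{M}_{p\times q}$: real $p\times q$ matrices; $\operatorname{Sym}(\mathbb{R}^d)$: symmetric $d\times d$ matrices; $M^{\rm sym}=\frac12(M+M^T)$. The generalized Jacobi group is $\operatorname{Jac}(\mathbb{R}^{2k},\mathbb{J};\mathbb{R}^d)=\operatorname{Sp}(\mathbb{R}^{2k},\mathbb{J})\times\mathcal{M}_{2k\times d}\times\operatorname{Sym}(\mathbb{R}^d)$, where $\operatorname{Sp}(\mathbb{R}^{2k},\mathbb{J})=\{g:g^T\mathbb{J}g=\mathbb{J}\}$, with multiplication $(g,\mathcal{A},\mathcal{B})(g',\mathcal{A}',\mathcal{B}')=(gg',\mathcal{A}+g\mathcal{A}',\mathcal{B}+\mathcal{B}'+\frac12(\mathcal{A}^T\mathbb{J}g\mathcal{A}')^{\rm sym})$. Its Lie algebra $\mathfrak{jac}=\mathfrak{sp}(\mathbb{R}^{2k},\mathbb{J})\times\mathcal{M}_{2k\times d}\times\operatorname{Sym}(\mathbb{R}^d)$ has bracket $[(\mathcal{S},\mathcal{A},\mathcal{B}),(\mathcal{S}',\mathcal{A}',\mathcal{B}')]=([\mathcal{S},\mathcal{S}'],\mathcal{S}\mathcal{A}'-\mathcal{S}'\mathcal{A},(\mathcal{A}^T\mathbb{J}\mathcal{A}')^{\rm sym})$, and its dual is identified with $\mathfrak{sp}(\mathbb{R}^{2k},\mathbb{J})\times\mathcal{M}_{d\times2k}\times\operatorname{Sym}(\mathbb{R}^d)\ni(\mathcal{X},\mathcal{K},\mathcal{M})$ via $\operatorname{Tr}(\mathcal{X}\mathcal{S})+\operatorname{Tr}(\mathcal{K}\mathcal{A})+\operatorname{Tr}(\mathcal{M}\mathcal{B})$.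 The generalized Heisenberg Lie algebra is the subalgebra $\mathfrak{h}(\mathbb{R}^{2k},\mathbb{J};\mathbb{R}^d)=\{\mathcal{S}=0\}$, with dual $\mathcal{M}_{d\times2k}\times\operatorname{Sym}(\mathbb{R}^d)\ni(\mathcal{K},\mathcal{M})$; its $\pm$ Lie--Poisson brackets are $\{f,g\}_\pm(\mathcal{K},\mathcal{M})=\pm\operatorname{Tr}\big(\mathcal{M}(\partial f/\partial\mathcal{K})^T\mathbb{J}\,\partial g/\partial\mathcal{K}\big)$, where $\mathbf{d}f\cdot(\delta\mathcal{K},0)=\operatorname{Tr}(\frac{\partial f}{\partial\mathcal{K}}\delta\mathcal{K})$. "Canonical" means each group element acts by a Poisson map. For a Lie group $G$ acting on a Poisson manifold $P$ on the left, with infinitesimal generators $\xi_P$, a map $\mathbf{J}:P\to\mathfrak{g}^*$ is a momentum map if $\{f,\langle\mathbf{J},\xi\rangle\}=\mathbf{d}f\cdot\xi_P$ for all $\xi\in\mathfrak{g}$ and smooth $f$; it is equivariant if $\mathbf{J}(g\cdot p)=\operatorname{Ad}^*_{g^{-1}}\mathbf{J}(p)$, where $\langle\operatorname{Ad}^*_{g^{-1}}\mu,\xi\rangle=\langle\mu,\operatorname{Ad}_{g^{-1}}\xi\rangle$. *)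

theory Defs
  imports "HOL-Analysis.Analysis" "HOL-Algebra.Group_Action"
begin

section \<open>Smooth maps on open subsets of Euclidean spaces\<close>

text \<open>
  \<open>Ck_on k f U\<close> is the class \<open>C\<^sup>k\<close>; the recursion is only meaningful for open \<open>U\<close>, since it
  refers to the Frechet derivative at the points of \<open>U\<close>.
\<close>

fun Ck_on :: "nat \<Rightarrow> ('a::euclidean_space \<Rightarrow> 'b::euclidean_space) \<Rightarrow> 'a set \<Rightarrow> bool" where
  "Ck_on 0 f U \<longleftrightarrow> continuous_on U f"
| "Ck_on (Suc k) f U \<longleftrightarrow>
     (\<forall>x\<in>U. f differentiable (at x)) \<and> (\<forall>v. Ck_on k (\<lambda>x. frechet_derivative f (at x) v) U)"

definition smooth_on :: "'a::euclidean_space set \<Rightarrow> ('a \<Rightarrow> 'b::euclidean_space) \<Rightarrow> bool" where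
  "smooth_on U f \<longleftrightarrow> (\<forall>k. Ck_on k f U)"


section \<open>The Euclidean space of symmetric matrices\<close>

typedef ('d::finite) sym_mat = "{M :: real^'d^'d. transpose M = M}"
  morphisms mat_of Abs_sym_mat
  by (rule exI[of _ 0]) (simp add: transpose_def vec_eq_iff)

setup_lifting type_definition_sym_mat

lift_definition sym_part :: "real^('d::finite)^'d \<Rightarrow> 'd sym_mat"
  is "\<lambda>M. (1/2) *\<^sub>R (M + transpose M)"
  by (simp add: transpose_def vec_eq_iff)

instantiation sym_mat :: (finite) real_vector
begin

lift_definition zero_sym_mat :: "'a sym_mat" is 0
  by (simp add: transpose_def vec_eq_iff)

lift_definition plus_sym_mat :: "'a sym_mat \<Rightarrow> 'a sym_mat \<Rightarrow> 'a sym_mat" is "(+)"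
  by (simp add: transpose_def vec_eq_iff)

lift_definition minus_sym_mat :: "'a sym_mat \<Rightarrow> 'a sym_mat \<Rightarrow> 'a sym_mat" is "(-)"
  by (simp add: transpose_def vec_eq_iff)

lift_definition uminus_sym_mat :: "'a sym_mat \<Rightarrow> 'a sym_mat" is uminus
  by (simp add: transpose_def vec_eq_iff)

lift_definition scaleR_sym_mat :: "real \<Rightarrow> 'a sym_mat \<Rightarrow> 'a sym_mat" is scaleR
  by (simp add: transpose_def vec_eq_iff)

instance
  by standard (transfer; simp add: algebra_simps)+

end

instantiation sym_mat :: (finite) real_inner
begin

lift_definition inner_sym_mat :: "'a sym_mat \<Rightarrow> 'a sym_mat \<Rightarrow> real" is inner .

lift_definition norm_sym_mat :: "'a sym_mat \<Rightarrow> real" is norm .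

definition dist_sym_mat :: "'a sym_mat \<Rightarrow> 'a sym_mat \<Rightarrow> real" where
  "dist_sym_mat A B = norm (A - B)"

definition sgn_sym_mat :: "'a sym_mat \<Rightarrow> 'a sym_mat" where
  "sgn_sym_mat A = inverse (norm A) *\<^sub>R A"

definition uniformity_sym_mat :: "('a sym_mat \<times> 'a sym_mat) filter" where
  "uniformity_sym_mat = (INF e\<in>{0<..}. principal {(x, y). dist x y < e})"

definition open_sym_mat :: "'a sym_mat set \<Rightarrow> bool" where
  "open_sym_mat U \<longleftrightarrow> (\<forall>x\<in>U. eventually (\<lambda>(x', y). x' = x \<longrightarrow> y \<in> U) uniformity)"

instance
proof
  fix x y z :: "'a sym_mat" and r :: real
  show "dist x y = norm (x - y)" by (fact dist_sym_mat_def)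
  show "sgn x = x /\<^sub>R norm x" by (fact sgn_sym_mat_def)
  show "uniformity = (INF e\<in>{0<..}. principal {(x, y::'a sym_mat). dist x y < e})"
    by (fact uniformity_sym_mat_def)
  show "open U \<longleftrightarrow> (\<forall>x\<in>U. eventually (\<lambda>(x', y). x' = x \<longrightarrow> y \<in> U) uniformity)"
    for U :: "'a sym_mat set"
    by (fact open_sym_mat_def)
  show "inner x y = inner y x" by transfer (rule inner_commute)
  show "inner (x + y) z = inner x z + inner y z" by transfer (rule inner_add_left)
  show "inner (r *\<^sub>R x) y = r * inner x y" by transfer simp
  show "0 \<le> inner x x" by transfer simp
  show "inner x x = 0 \<longleftrightarrow> x = 0" by transfer simp
  show "norm x = sqrt (inner x x)" by transfer (rule norm_eq_sqrt_inner)
qed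

end

lemma sym_mat_orthonormal_basis:
  "\<exists>B :: ('d::finite) sym_mat set. B \<noteq> {} \<and> finite B \<and>
     (\<forall>u\<in>B. \<forall>v\<in>B. inner u v = (if u = v then 1 else 0)) \<and>
     (\<forall>x. (\<forall>u\<in>B. inner x u = 0) \<longleftrightarrow> x = 0)"
proof -
  let ?S = "{M :: real^'d^'d. transpose M = M}"
  have sub: "subspace ?S"
    by (auto simp: subspace_def transpose_def vec_eq_iff)
  obtain B where B: "B \<subseteq> ?S" "pairwise orthogonal B" "\<And>x. x \<in> B \<Longrightarrow> norm x = 1"
      "independent B" "card B = dim ?S" "span B = ?S"
    using orthonormal_basis_subspace[OF sub] by blast
  have fin: "finite B" using B(4) by (rule independent_imp_finite)
  let ?C = "Abs_sym_mat ` B"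
  have inn: "inner (Abs_sym_mat u) (Abs_sym_mat v) = inner u v" if "u \<in> B" "v \<in> B" for u v
    using that B(1) by (simp add: inner_sym_mat.rep_eq Abs_sym_mat_inverse subset_iff)
  have orth: "\<forall>u\<in>?C. \<forall>v\<in>?C. inner u v = (if u = v then 1 else 0)"
  proof (intro ballI)
    fix u v assume "u \<in> ?C" "v \<in> ?C"
    then obtain a b where ab: "a \<in> B" "b \<in> B" "u = Abs_sym_mat a" "v = Abs_sym_mat b" by blast
    have eq: "u = v \<longleftrightarrow> a = b"
      using ab B(1) by (simp add: Abs_sym_mat_inject subset_iff)
    show "inner u v = (if u = v then 1 else 0)"
      using ab B(2,3) eq inn[OF ab(1,2)]
      by (auto simp: pairwise_def orthogonal_def dot_square_norm)
  qed
  have tot: "x = 0" if "\<forall>u\<in>?C. inner x u = 0" for x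
  proof -
    have "inner (mat_of x) b = 0" if "b \<in> B" for b
      using that \<open>\<forall>u\<in>?C. inner x u = 0\<close> B(1)
      by (auto simp: inner_sym_mat.rep_eq Abs_sym_mat_inverse subset_iff)
    moreover have "mat_of x \<in> span B" using B(6) mat_of[of x] by simp
    ultimately have "inner (mat_of x) (mat_of x) = 0"
      using orthogonal_to_span[of "mat_of x" B "mat_of x"] by (simp add: orthogonal_def)
    then show "x = 0" by (simp flip: inner_sym_mat.rep_eq)
  qed
  have "mat 1 \<in> ?S" by (simp add: transpose_mat)
  moreover have "(mat 1 :: real^'d^'d) \<noteq> 0" by (simp add: mat_def vec_eq_iff)
  ultimately have "B \<noteq> {}" using B(6) by auto
  then show ?thesis
    using fin orth tot by (intro exI[of _ ?C]) auto
qed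

instantiation sym_mat :: (finite) euclidean_space
begin

definition Basis_sym_mat :: "'a sym_mat set" where
  "Basis_sym_mat = (SOME B. B \<noteq> {} \<and> finite B \<and>
     (\<forall>u\<in>B. \<forall>v\<in>B. inner u v = (if u = v then 1 else 0)) \<and>
     (\<forall>x. (\<forall>u\<in>B. inner x u = 0) \<longleftrightarrow> x = 0))"

instance
proof -
  let ?P = "\<lambda>B :: 'a sym_mat set. B \<noteq> {} \<and> finite B \<and>
     (\<forall>u\<in>B. \<forall>v\<in>B. inner u v = (if u = v then 1 else 0)) \<and>
     (\<forall>x. (\<forall>u\<in>B. inner x u = 0) \<longleftrightarrow> x = 0)"
  have P: "?P Basis"
    unfolding Basis_sym_mat_def by (rule someI_ex) (rule sym_mat_orthonormal_basis)
  show "OFCLASS('a sym_mat, euclidean_space_class)"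
    by standard (use P in blast)+
qed

end


section \<open>The generalized Jacobi group and the duals\<close>

text \<open>
  Throughout, the index type \<open>'n\<close> has \<open>2k\<close> elements and the index type \<open>'d\<close> has \<open>d\<close> elements;
  a \<open>p \<times> q\<close> matrix has type \<open>real^'q^'p\<close>. The group \<open>Jac\<close>, its Lie algebra and the dual of the
  latter are carrier sets in the types \<open>jac\<close>, \<open>jac\<close> and \<open>jac_dual\<close>, because the symplectic
  condition depends on the matrix \<open>J\<close>.
\<close>

type_synonym ('n, 'd) jac = "(real^'n^'n) \<times> (real^'d^'n) \<times> 'd sym_mat"
type_synonym ('n, 'd) jac_dual = "(real^'n^'n) \<times> (real^'n^'d) \<times> 'd sym_mat"
type_synonym ('n, 'd) heis_dual = "(real^'n^'d) \<times> 'd sym_mat"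

definition Sp :: "real^('n::finite)^'n \<Rightarrow> (real^'n^'n) set" where
  "Sp J = {g. transpose g ** J ** g = J}"

definition sp :: "real^('n::finite)^'n \<Rightarrow> (real^'n^'n) set" where
  "sp J = {S. transpose S ** J + J ** S = 0}"

fun jac_mult ::
  "real^('n::finite)^'n \<Rightarrow> ('n, 'd::finite) jac \<Rightarrow> ('n, 'd) jac \<Rightarrow> ('n, 'd) jac" where
  "jac_mult J (g, A, B) (g', A', B') =
     (g ** g', A + g ** A', B + B' + (1/2) *\<^sub>R sym_part (transpose A ** J ** g ** A'))"

definition Jac :: "real^('n::finite)^'n \<Rightarrow> ('n, 'd::finite) jac monoid" where
  "Jac J = \<lparr> carrier = Sp J \<times> UNIV, mult = jac_mult J, one = (mat 1, 0, 0) \<rparr>"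

definition jac_algebra :: "real^('n::finite)^'n \<Rightarrow> ('n, 'd::finite) jac set" where
  "jac_algebra J = sp J \<times> UNIV"

definition jac_dual_space :: "real^('n::finite)^'n \<Rightarrow> ('n, 'd::finite) jac_dual set" where
  "jac_dual_space J = sp J \<times> UNIV"

fun jac_pairing :: "('n::finite, 'd::finite) jac_dual \<Rightarrow> ('n, 'd) jac \<Rightarrow> real" where
  "jac_pairing (X, K, M) (S, A, B) = trace (X ** S) + trace (K ** A) + trace (mat_of M ** mat_of B)"


section \<open>Exponential map, adjoint and coadjoint action\<close>

definition one_parameter_subgroup ::
  "real^('n::finite)^'n \<Rightarrow> ('n, 'd::finite) jac \<Rightarrow> (real \<Rightarrow> ('n, 'd) jac) \<Rightarrow> bool" where
  "one_parameter_subgroup J \<xi> c \<longleftrightarrow>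
     (\<forall>t. c t \<in> carrier (Jac J)) \<and> (\<forall>s t. c (s + t) = c s \<otimes>\<^bsub>Jac J\<^esub> c t) \<and>
     (c has_vector_derivative \<xi>) (at 0)"

definition jac_exp :: "real^('n::finite)^'n \<Rightarrow> ('n, 'd::finite) jac \<Rightarrow> ('n, 'd) jac" where
  "jac_exp J \<xi> = (THE c. one_parameter_subgroup J \<xi> c) 1"

definition jac_Ad ::
  "real^('n::finite)^'n \<Rightarrow> ('n, 'd::finite) jac \<Rightarrow> ('n, 'd) jac \<Rightarrow> ('n, 'd) jac" where
  "jac_Ad J a \<xi> =
     vector_derivative (\<lambda>t. a \<otimes>\<^bsub>Jac J\<^esub> jac_exp J (t *\<^sub>R \<xi>) \<otimes>\<^bsub>Jac J\<^esub> inv\<^bsub>Jac J\<^esub> a) (at 0)"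

text \<open>\<open>jac_Ad_star J a\<close> is the transpose of \<open>jac_Ad J a\<close> under the pairing.\<close>

definition jac_Ad_star ::
  "real^('n::finite)^'n \<Rightarrow> ('n, 'd::finite) jac \<Rightarrow> ('n, 'd) jac_dual \<Rightarrow> ('n, 'd) jac_dual" where
  "jac_Ad_star J a \<mu> = (THE \<nu>. \<nu> \<in> jac_dual_space J \<and>
     (\<forall>\<xi>\<in>jac_algebra J. jac_pairing \<nu> \<xi> = jac_pairing \<mu> (jac_Ad J a \<xi>)))"


section \<open>The Lie--Poisson structure and the action\<close>

definition partial_K ::
  "(('n::finite, 'd::finite) heis_dual \<Rightarrow> real) \<Rightarrow> ('n, 'd) heis_dual \<Rightarrow> real^'d^'n" where
  "partial_K f p = (THE D. \<forall>\<delta>K. frechet_derivative f (at p) (\<delta>K, 0) = trace (D ** \<delta>K))"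

text \<open>The argument \<open>\<sigma>\<close> is the sign \<open>1\<close> or \<open>-1\<close> of the Lie--Poisson bracket.\<close>

definition lie_poisson ::
  "real \<Rightarrow> real^('n::finite)^'n \<Rightarrow> (('n, 'd::finite) heis_dual \<Rightarrow> real) \<Rightarrow>
   (('n, 'd) heis_dual \<Rightarrow> real) \<Rightarrow> ('n, 'd) heis_dual \<Rightarrow> real" where
  "lie_poisson \<sigma> J f h p =
     \<sigma> * trace (mat_of (snd p) ** transpose (partial_K f p) ** J ** partial_K h p)"

definition poisson_map ::
  "(('p \<Rightarrow> real) \<Rightarrow> ('p \<Rightarrow> real) \<Rightarrow> 'p \<Rightarrow> real) \<Rightarrow> 'p::euclidean_space set \<Rightarrow> ('p \<Rightarrow> 'p) \<Rightarrow> bool" where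
  "poisson_map br U \<phi> \<longleftrightarrow> smooth_on U \<phi> \<and> \<phi> ` U \<subseteq> U \<and>
     (\<forall>f h. smooth_on U f \<longrightarrow> smooth_on U h \<longrightarrow>
        (\<forall>p\<in>U. br (f \<circ> \<phi>) (h \<circ> \<phi>) p = br f h (\<phi> p)))"

fun jac_action ::
  "real^('n::finite)^'n \<Rightarrow> ('n, 'd::finite) jac \<Rightarrow> ('n, 'd) heis_dual \<Rightarrow> ('n, 'd) heis_dual" where
  "jac_action J (g, A, B) (K, M) = (K ** matrix_inv g - mat_of M ** transpose A ** J, M)"

definition jac_generator ::
  "real^('n::finite)^'n \<Rightarrow> ('n, 'd::finite) jac \<Rightarrow> ('n, 'd) heis_dual \<Rightarrow> ('n, 'd) heis_dual" where
  "jac_generator J \<xi> p = vector_derivative (\<lambda>t. jac_action J (jac_exp J (t *\<^sub>R \<xi>)) p) (at 0)"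

definition is_momentum_map ::
  "((('n, 'd) heis_dual \<Rightarrow> real) \<Rightarrow> (('n, 'd) heis_dual \<Rightarrow> real) \<Rightarrow> ('n, 'd) heis_dual \<Rightarrow> real) \<Rightarrow>
   real^('n::finite)^'n \<Rightarrow> ('n, 'd::finite) heis_dual set \<Rightarrow>
   (('n, 'd) heis_dual \<Rightarrow> ('n, 'd) jac_dual) \<Rightarrow> bool" where
  "is_momentum_map br J U \<Phi> \<longleftrightarrow> smooth_on U \<Phi> \<and> \<Phi> ` U \<subseteq> jac_dual_space J \<and>
     (\<forall>\<xi>\<in>jac_algebra J. \<forall>f. smooth_on U f \<longrightarrow>
        (\<forall>p\<in>U. br f (\<lambda>q. jac_pairing (\<Phi> q) \<xi>) p =
                frechet_derivative f (at p) (jac_generator J \<xi> p)))"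

definition is_equivariant ::
  "real^('n::finite)^'n \<Rightarrow> ('n, 'd::finite) heis_dual set \<Rightarrow>
   (('n, 'd) heis_dual \<Rightarrow> ('n, 'd) jac_dual) \<Rightarrow> bool" where
  "is_equivariant J U \<Phi> \<longleftrightarrow> (\<forall>a\<in>carrier (Jac J). \<forall>p\<in>U.
     \<Phi> (jac_action J a p) = jac_Ad_star J (inv\<^bsub>Jac J\<^esub> a) (\<Phi> p))"

definition heis_dual_reg :: "('n::finite, 'd::finite) heis_dual set" where
  "heis_dual_reg = {(K, M). det (mat_of M) \<noteq> 0}"

fun Psi :: "real^('n::finite)^'n \<Rightarrow> ('n, 'd::finite) heis_dual \<Rightarrow> ('n, 'd) jac_dual" where
  "Psi J (K, M) =
     ((1/2) *\<^sub>R (matrix_inv J ** transpose K ** matrix_inv (mat_of M) ** K), K, M)"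

end

theory Submission
  imports Defs
begin

text \<open>
  A curve \<open>c\<close> is the one-parameter subgroup generated by \<open>\<xi>\<close> iff it solves the left-invariant differential
  equation \<open>c' = jac_left c \<xi>\<close>, \<open>c 0 = 1\<close>. This equation is triangular: its \<open>g\<close>-component is the linear
  equation \<open>g' = g S\<close>, solved by the matrix exponential, and the other two components are then
  antiderivatives. Hence \<open>jac_exp J (t \<xi>) = c t\<close> and the infinitesimal generators and the adjoint action
  can be computed by differentiating at \<open>0\<close>. For \<open>g \<in> Sp J\<close> one has \<open>g\<^sup>T J = J g\<^sup>-\<^sup>1\<close> and for \<open>S \<in> sp J\<close>
  one has \<open>S\<^sup>T J = - J S\<close>; with these the action, Poisson, momentum and equivariance identities reduce to
  cyclicity and transposition invariance of the trace.
\<close>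

section \<open>Matrix calculus\<close>

text \<open>The exponential and the coadjoint action are defined by definite descriptions, so each
  computation rests on a uniqueness argument: that of solutions of the differential equation for
  \<open>jac_exp\<close>, and nondegeneracy of the trace pairing for \<open>jac_Ad_star\<close>. In
  the latter the usual test matrix, the transpose, need not lie in \<open>sp J\<close>. The form of
  \<open>Psi\<close> can be read off a level set of \<open>M\<close>: there the bracket has
  coefficients independent of \<open>K\<close>, built from \<open>M\<close> and \<open>J\<close>,
  and it is symplectic exactly when \<open>det M\<close> is nonzero. A generator that is linear in
  \<open>K\<close> then needs a Hamiltonian quadratic in \<open>K\<close>, obtained by inverting
  \<open>M\<close>; this accounts for the factor 1/2 and for \<open>matrix_inv (mat_of M)\<close>.
  Hamiltonians linear in \<open>K\<close> produce the translations by
  \<open>M ** transpose A ** J\<close>. The price of the inverse is that smoothness of matrix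
  inversion has to be established for the recursive notion \<open>Ck_on\<close>.\<close>

lemma bounded_bilinear_matrix_mult:
  "bounded_bilinear ((**) :: real^'n^'m \<Rightarrow> real^'p^'n \<Rightarrow> real^'p^'m)"
  unfolding bilinear_conv_bounded_bilinear[symmetric] bilinear_def
  by (auto intro!: linearI simp: vec_eq_iff matrix_matrix_mult_def sum.distrib sum_distrib_left algebra_simps)

interpretation matrix_mult: bounded_bilinear "(**) :: real^'n^'m \<Rightarrow> real^'p^'n \<Rightarrow> real^'p^'m"
  by (rule bounded_bilinear_matrix_mult)

lemmas matrix_mult_linear =
  matrix_mult.add_left matrix_mult.add_right matrix_mult.diff_left matrix_mult.diff_right
  matrix_mult.minus_left matrix_mult.minus_right matrix_mult.scaleR_left matrix_mult.scaleR_right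

lemma bounded_linear_transpose: "bounded_linear (transpose :: real^'n^'m \<Rightarrow> real^'m^'n)"
  unfolding linear_conv_bounded_linear[symmetric]
  by (rule linearI) (simp_all add: transpose_def vec_eq_iff)

lemma bounded_linear_trace: "bounded_linear (trace :: real^'n^'n \<Rightarrow> real)"
  unfolding linear_conv_bounded_linear[symmetric]
  by (rule linearI) (simp_all add: trace_def sum.distrib sum_distrib_left)

lemma bounded_linear_mat_of: "bounded_linear (mat_of :: 'd::finite sym_mat \<Rightarrow> real^'d^'d)"
  unfolding linear_conv_bounded_linear[symmetric]
  by (rule linearI) (simp_all add: plus_sym_mat.rep_eq scaleR_sym_mat.rep_eq)

lemma bounded_linear_sym_part: "bounded_linear (sym_part :: real^'d^'d \<Rightarrow> 'd::finite sym_mat)"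
  unfolding linear_conv_bounded_linear[symmetric]
  by (rule linearI; transfer) (simp_all add: transpose_def vec_eq_iff algebra_simps)

lemmas matrix_linear = matrix_mult_linear
  linear_add[OF bounded_linear_transpose[THEN bounded_linear.linear]]
  linear_diff[OF bounded_linear_transpose[THEN bounded_linear.linear]]
  linear_neg[OF bounded_linear_transpose[THEN bounded_linear.linear]]
  linear_scale[OF bounded_linear_transpose[THEN bounded_linear.linear]]
  linear_add[OF bounded_linear_trace[THEN bounded_linear.linear]]
  linear_diff[OF bounded_linear_trace[THEN bounded_linear.linear]]
  linear_neg[OF bounded_linear_trace[THEN bounded_linear.linear]]
  linear_scale[OF bounded_linear_trace[THEN bounded_linear.linear]]
  linear_add[OF bounded_linear_mat_of[THEN bounded_linear.linear]]
  linear_diff[OF bounded_linear_mat_of[THEN bounded_linear.linear]]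
  linear_neg[OF bounded_linear_mat_of[THEN bounded_linear.linear]]
  linear_scale[OF bounded_linear_mat_of[THEN bounded_linear.linear]]
  linear_add[OF bounded_linear_sym_part[THEN bounded_linear.linear]]
  linear_diff[OF bounded_linear_sym_part[THEN bounded_linear.linear]]
  linear_neg[OF bounded_linear_sym_part[THEN bounded_linear.linear]]
  linear_scale[OF bounded_linear_sym_part[THEN bounded_linear.linear]]

lemma transpose_zero [simp]: "transpose 0 = (0 :: real^'n^'m)"
  by (simp add: transpose_def vec_eq_iff)

lemma sym_part_zero [simp]: "sym_part 0 = 0"
  by transfer simp

lemma trace_transpose: "trace (transpose A) = trace A"
  by (simp add: trace_def transpose_def)

lemma transpose_mat_of [simp]: "transpose (mat_of M) = mat_of M"
  using mat_of[of M] by simp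

lemma sym_part_transpose [simp]: "sym_part (transpose A) = sym_part A"
  by transfer (simp add: add.commute)

lemma trace_mat_of_sym_part: "trace (mat_of M ** mat_of (sym_part X)) = trace (mat_of M ** X)"
proof -
  have "trace (mat_of M ** transpose X) = trace (mat_of M ** X)"
    by (metis matrix_transpose_mul trace_mul_sym trace_transpose transpose_mat_of)
  then show ?thesis
    by (simp add: sym_part.rep_eq matrix_linear)
qed

text \<open>The trace is the squared Euclidean norm of \<open>A\<close>. Testing a difference
  against its own transpose therefore proves equality of matrices, both for \<open>partial_K\<close>
  and for the dual pairing.\<close>

lemma trace_mult_transpose_eq_0_iff: "trace (A ** transpose A) = 0 \<longleftrightarrow> A = 0"
  for A :: "real^'n^'m"
proof -
  have "trace (A ** transpose A) = inner A A"
    by (simp add: trace_def matrix_matrix_mult_def transpose_def inner_vec_def)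
  then show ?thesis by simp
qed

text \<open>\<open>matrix_inv\<close> is a choice operator; for square matrices a one-sided inverse
  is two-sided, which pins the choice down.\<close>

lemma matrix_inv_unique:
  fixes A B :: "real^'n^'n"
  assumes "A ** B = mat 1"
  shows "matrix_inv A = B"
proof -
  have "A ** matrix_inv A = mat 1 \<and> matrix_inv A ** A = mat 1"
    unfolding matrix_inv_def
    by (rule someI[of _ B]) (use assms matrix_left_right_inverse in blast)
  then show ?thesis
    by (metis assms matrix_mul_assoc matrix_mul_lid matrix_mul_rid)
qed

lemma matrix_inv_inverse:
  fixes A :: "real^'n^'n"
  assumes "invertible A"
  shows "A ** matrix_inv A = mat 1" "matrix_inv A ** A = mat 1"
  using assms matrix_inv_unique unfolding invertible_def by blast+

section \<open>Differentiability of determinants and of matrix inversion\<close>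

lemma has_derivative_matrixI:
  fixes f :: "'a::real_normed_vector \<Rightarrow> real^'n^'m"
  assumes "\<And>i j. ((\<lambda>x. f x $ i $ j) has_derivative (\<lambda>h. f' h $ i $ j)) (at x)"
  shows "(f has_derivative f') (at x)"
  unfolding has_derivative_componentwise_within[of f]
  using assms by (auto simp: Basis_vec_def inner_axis)

lemma has_vector_derivative_matrixI:
  fixes f :: "real \<Rightarrow> real^'n^'m"
  assumes "\<And>i j. ((\<lambda>t. f t $ i $ j) has_field_derivative f' $ i $ j) (at t)"
  shows "(f has_vector_derivative f') (at t)"
  unfolding has_vector_derivative_def
  by (rule has_derivative_matrixI)
     (use assms in \<open>simp add: has_field_derivative_def mult_commute_abs\<close>)

lemma differentiable_prod:
  fixes f :: "'i \<Rightarrow> 'a::real_normed_vector \<Rightarrow> real"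
  assumes "\<And>i. i \<in> I \<Longrightarrow> f i differentiable (at x)"
  shows "(\<lambda>y. \<Prod>i\<in>I. f i y) differentiable (at x)"
proof -
  obtain f' where "\<And>i. i \<in> I \<Longrightarrow> (f i has_derivative f' i) (at x)"
    using assms unfolding differentiable_def by metis
  from has_derivative_prod[OF this] show ?thesis
    by (rule differentiableI)
qed

lemma differentiable_det:
  fixes F :: "'a::real_normed_vector \<Rightarrow> real^'n^'n"
  assumes "\<And>i j. (\<lambda>y. F y $ i $ j) differentiable (at x)"
  shows "(\<lambda>y. det (F y)) differentiable (at x)"
  unfolding det_def
  by (intro differentiable_sum differentiable_mult differentiable_const differentiable_prod assms ballI)
     simp

lemma differentiable_entry: "(\<lambda>A::real^'n^'m. A $ i $ j) differentiable (at x)"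
  by (intro differentiableI[OF bounded_linear_imp_has_derivative])
     (intro bounded_linear_compose[OF bounded_linear_vec_nth] bounded_linear_vec_nth)

lemma open_det_nonzero: "open {A :: real^'n^'n. det A \<noteq> 0}"
proof -
  have "continuous_on UNIV (det :: real^'n^'n \<Rightarrow> real)"
    by (intro differentiable_imp_continuous_on)
       (simp add: differentiable_on_def differentiable_det differentiable_entry)
  then show ?thesis
    by (simp add: open_Collect_neq)
qed

text \<open>Cramer's rule for \<open>A x = axis j 1\<close>, whose solution is column
  \<open>j\<close> of the inverse. It displays the entries as quotients of determinants, so
  differentiability needs no estimates on inverses.\<close>

lemma matrix_inv_entry:
  fixes A :: "real^'n^'n"
  assumes "det A \<noteq> 0"
  shows "matrix_inv A $ i $ j = det (\<chi> r c. if c = i then axis j 1 $ r else A $ r $ c) / det A"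
proof -
  have "A *v (matrix_inv A *v axis j 1) = axis j 1"
    using assms by (simp add: matrix_vector_mul_assoc matrix_inv_inverse invertible_det_nz)
  then have "(matrix_inv A *v axis j 1) $ i = det (\<chi> r c. if c = i then axis j 1 $ r else A $ r $ c) / det A"
    by (subst (asm) cramer[OF assms]) simp
  then show ?thesis by (simp add: matrix_vector_mult_basis column_def)
qed

lemma differentiable_matrix_inv:
  fixes A :: "real^'n^'n"
  assumes "det A \<noteq> 0"
  shows "matrix_inv differentiable (at A)"
proof -
  have "(\<lambda>A. matrix_inv A $ i $ j) differentiable (at A)" for i j :: 'n
  proof -
    let ?c = "\<lambda>A::real^'n^'n. det (\<chi> r c. if c = i then axis j 1 $ r else A $ r $ c) / det A"
    have "(\<lambda>A::real^'n^'n. (\<chi> r c. if c = i then axis j 1 $ r else A $ r $ c) $ r $ c) differentiable (at A)"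
      for r c by (cases "c = i") (simp_all add: differentiable_entry)
    then have "?c differentiable (at A)"
      by (intro differentiable_divide differentiable_det differentiable_entry) (use assms in auto)
    then obtain D where "(?c has_derivative D) (at A)"
      unfolding differentiable_def by blast
    \<comment> \<open>Cramer's formula is available only where the determinant is nonzero; this set
      is open, so the derivative of the quotient carries over.\<close>
    then have "((\<lambda>A. matrix_inv A $ i $ j) has_derivative D) (at A)"
      by (rule has_derivative_transform_within_open[OF _ open_det_nonzero])
         (use assms in \<open>auto simp: matrix_inv_entry\<close>)
    then show ?thesis by (rule differentiableI)
  qed
  then obtain D where D: "\<And>i j. ((\<lambda>A. matrix_inv A $ i $ j) has_derivative D i j) (at A)"
    unfolding differentiable_def by metis
  have "(matrix_inv has_derivative (\<lambda>h. \<chi> i j. D i j h)) (at A)"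
    by (rule has_derivative_matrixI) (simp add: D)
  then show ?thesis by (rule differentiableI)
qed

text \<open>Once some derivative \<open>D\<close> exists its formula is forced:
  \<open>X ** matrix_inv X\<close> is constant near \<open>A\<close>, and the product rule can be
  solved for \<open>D H\<close>.\<close>

lemma has_derivative_matrix_inv:
  fixes A :: "real^'n^'n"
  assumes "det A \<noteq> 0"
  shows "(matrix_inv has_derivative (\<lambda>H. - (matrix_inv A ** H ** matrix_inv A))) (at A)"
proof -
  obtain D where D: "(matrix_inv has_derivative D) (at A)"
    using differentiable_matrix_inv[OF assms] unfolding differentiable_def by blast
  have "((\<lambda>X. X ** matrix_inv X) has_derivative (\<lambda>H. A ** D H + H ** matrix_inv A)) (at A)"
    by (rule matrix_mult.FDERIV[OF has_derivative_ident D])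
  moreover have "((\<lambda>X. X ** matrix_inv X) has_derivative (\<lambda>H. 0)) (at A)"
    by (rule has_derivative_transform_within_open[OF has_derivative_const[of "mat 1"] open_det_nonzero])
       (use assms in \<open>auto simp: matrix_inv_inverse invertible_det_nz\<close>)
  ultimately have "(\<lambda>H. A ** D H + H ** matrix_inv A) = (\<lambda>H. 0)"
    by (rule has_derivative_unique)
  then have "A ** D H = - (H ** matrix_inv A)" for H
    by (metis eq_neg_iff_add_eq_0)
  then have "matrix_inv A ** (A ** D H) = - (matrix_inv A ** H ** matrix_inv A)" for H
    by (simp add: matrix_mult.minus_right matrix_mul_assoc)
  then have "D = (\<lambda>H. - (matrix_inv A ** H ** matrix_inv A))"
    using assms by (simp add: matrix_mul_assoc matrix_inv_inverse invertible_det_nz fun_eq_iff)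
  with D show ?thesis by simp
qed

section \<open>Closure properties of smooth maps\<close>

text \<open>The third premise is congruence of \<open>Ck_on k\<close> on \<open>U\<close>. As a
  premise it can be supplied by the induction hypothesis in the proof of \<open>Ck_on_cong\<close>,
  which then removes it for all later uses.\<close>

lemma Ck_on_SucI:
  fixes f :: "'a::euclidean_space \<Rightarrow> 'b::euclidean_space"
  assumes "\<And>x. x \<in> U \<Longrightarrow> (f has_derivative f' x) (at x)"
    and "\<And>v. Ck_on k (\<lambda>x. f' x v) U"
    and "\<And>g h :: 'a \<Rightarrow> 'b. (\<And>x. x \<in> U \<Longrightarrow> g x = h x) \<Longrightarrow> Ck_on k g U \<Longrightarrow> Ck_on k h U"
  shows "Ck_on (Suc k) f U"
proof -
  have f': "frechet_derivative f (at x) = f' x" if "x \<in> U" for x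
    using frechet_derivative_at[OF assms(1)[OF that]] by simp
  have "Ck_on k (\<lambda>x. frechet_derivative f (at x) v) U" for v
    by (rule assms(3)[rotated, OF assms(2)[of v]]) (simp add: f')
  with assms(1) show ?thesis
    by (auto intro: differentiableI)
qed

text \<open>Openness matters because a Frechet derivative at a point of \<open>U\<close> depends on
  values in a whole neighbourhood.\<close>

lemma Ck_on_cong:
  assumes "open U" "\<And>x. x \<in> U \<Longrightarrow> f x = g x" "Ck_on k f U"
  shows "Ck_on k g U"
  using assms
proof (induction k arbitrary: f g)
  case 0
  then show ?case by (simp cong: continuous_on_cong)
next
  case (Suc k)
  have f': "(f has_derivative frechet_derivative f (at x)) (at x)" if "x \<in> U" for x
    using Suc.prems(3) that by (simp flip: frechet_derivative_works)
  show ?case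
  proof (rule Ck_on_SucI)
    show "(g has_derivative frechet_derivative f (at x)) (at x)" if "x \<in> U" for x
      by (rule has_derivative_transform_within_open[OF f'[OF that] \<open>open U\<close> that]) (rule Suc.prems(2))
    show "Ck_on k (\<lambda>x. frechet_derivative f (at x) v) U" for v
      using Suc.prems(3) by simp
    show "Ck_on k h' U" if "\<And>x. x \<in> U \<Longrightarrow> g' x = h' x" "Ck_on k g' U"
      for g' h' :: "'a \<Rightarrow> 'b"
      using Suc.IH \<open>open U\<close> that by blast
  qed
qed

lemma Ck_on_Suc_has_derivative:
  assumes "open U" "\<And>x. x \<in> U \<Longrightarrow> (f has_derivative f' x) (at x)" "\<And>v. Ck_on k (\<lambda>x. f' x v) U"
  shows "Ck_on (Suc k) f U"
  by (rule Ck_on_SucI[where f' = f']) (fact assms, fact assms, rule Ck_on_cong[OF assms(1)])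

lemma Ck_on_has_derivative:
  assumes "Ck_on (Suc k) f U" "x \<in> U"
  shows "(f has_derivative frechet_derivative f (at x)) (at x)"
  using assms by (simp flip: frechet_derivative_works)

lemma Ck_on_Suc_imp: "Ck_on (Suc k) f U \<Longrightarrow> Ck_on k f U"
proof (induction k arbitrary: f)
  case 0
  then show ?case
    by (auto intro!: continuous_at_imp_continuous_on differentiable_imp_continuous_within)
next
  case (Suc k)
  then show ?case by (simp del: Ck_on.simps(2) add: Ck_on.simps(2)[of "Suc k"])
     (simp add: Ck_on.simps(2)[of k])
qed

lemma Ck_on_const: "open U \<Longrightarrow> Ck_on k (\<lambda>x. c) U"
proof (induction k arbitrary: c)
  case (Suc k)
  then show ?case
    by (intro Ck_on_Suc_has_derivative[where f' = "\<lambda>_ _. 0"]) auto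
qed simp

lemma Ck_on_bounded_linear:
  assumes "bounded_linear L" "open U"
  shows "Ck_on k L U"
proof (cases k)
  case 0
  with assms(1) show ?thesis by (simp add: linear_continuous_on)
next
  case (Suc n)
  with assms show ?thesis
    by (auto simp del: Ck_on.simps intro: bounded_linear_imp_has_derivative Ck_on_const
        intro!: Ck_on_Suc_has_derivative[where f' = "\<lambda>_. L"])
qed

lemma Ck_on_add:
  assumes "open U" "Ck_on k f U" "Ck_on k g U"
  shows "Ck_on k (\<lambda>x. f x + g x) U"
  using assms(2,3)
proof (induction k arbitrary: f g)
  case 0
  then show ?case by (simp add: continuous_on_add)
next
  case (Suc k)
  show ?case
  proof (rule Ck_on_Suc_has_derivative[OF assms(1)])
    show "((\<lambda>x. f x + g x) has_derivative
        (\<lambda>v. frechet_derivative f (at x) v + frechet_derivative g (at x) v)) (at x)" if "x \<in> U" for x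
      using Suc.prems that by (intro has_derivative_add Ck_on_has_derivative)
    show "Ck_on k (\<lambda>x. frechet_derivative f (at x) v + frechet_derivative g (at x) v) U" for v
      using Suc.prems by (intro Suc.IH) simp_all
  qed
qed

text \<open>The Leibniz rule gives two summands of the same bilinear shape, each with one
  undifferentiated factor; that factor is one order smoother than required, hence the appeal to
  \<open>Ck_on_Suc_imp\<close>.\<close>

lemma Ck_on_bilinear:
  assumes "bounded_bilinear b" "open U" "Ck_on k f U" "Ck_on k g U"
  shows "Ck_on k (\<lambda>x. b (f x) (g x)) U"
  using assms(3,4)
proof (induction k arbitrary: f g)
  case 0
  then show ?case by (simp add: bounded_bilinear.continuous_on[OF assms(1)])
next
  case (Suc k)
  show ?case
  proof (rule Ck_on_Suc_has_derivative[OF assms(2)])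
    show "((\<lambda>x. b (f x) (g x)) has_derivative
        (\<lambda>v. b (f x) (frechet_derivative g (at x) v) + b (frechet_derivative f (at x) v) (g x))) (at x)"
      if "x \<in> U" for x
      using Suc.prems that by (intro bounded_bilinear.FDERIV[OF assms(1)] Ck_on_has_derivative)
    show "Ck_on k (\<lambda>x. b (f x) (frechet_derivative g (at x) v) + b (frechet_derivative f (at x) v) (g x)) U"
      for v
      using Suc.prems by (intro Ck_on_add Suc.IH assms(2)) (auto intro: Ck_on_Suc_imp)
  qed
qed

lemma Ck_on_linear_compose:
  assumes "bounded_linear L" "open U" "Ck_on k f U"
  shows "Ck_on k (\<lambda>x. L (f x)) U"
  using assms(3)
proof (induction k arbitrary: f)
  case 0
  then show ?case by (simp add: bounded_linear.continuous_on[OF assms(1)])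
next
  case (Suc k)
  show ?case
  proof (rule Ck_on_Suc_has_derivative[OF assms(2)])
    show "((\<lambda>x. L (f x)) has_derivative (\<lambda>v. L (frechet_derivative f (at x) v))) (at x)"
      if "x \<in> U" for x
      using Suc.prems that by (intro bounded_linear.has_derivative[OF assms(1)] Ck_on_has_derivative)
    show "Ck_on k (\<lambda>x. L (frechet_derivative f (at x) v)) U" for v
      using Suc.prems by (intro Suc.IH) simp_all
  qed
qed

text \<open>A pair is the sum of two linear embeddings, so no further induction is needed.\<close>

lemma Ck_on_Pair:
  assumes "open U" "Ck_on k f U" "Ck_on k g U"
  shows "Ck_on k (\<lambda>x. (f x, g x)) U"
proof -
  have "Ck_on k (\<lambda>x. (f x, 0) + (0, g x)) U"
    using assms
    by (intro Ck_on_add Ck_on_linear_compose[of "\<lambda>y. (y, 0)"] Ck_on_linear_compose[of "Pair 0"]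
        bounded_linear_Pair bounded_linear_ident bounded_linear_zero)
  then show ?thesis by simp
qed

text \<open>A bootstrap: the derivative is a product of two copies of the inverse and a derivative
  of \<open>F\<close>, so the order already known for the inverse yields the next one.\<close>

lemma Ck_on_matrix_inv:
  fixes F :: "'a::euclidean_space \<Rightarrow> real^'n^'n"
  assumes "open U" "\<And>x. x \<in> U \<Longrightarrow> det (F x) \<noteq> 0" "Ck_on k F U"
  shows "Ck_on k (\<lambda>x. matrix_inv (F x)) U"
  using assms(3)
proof (induction k)
  case 0
  have "continuous_on {A::real^'n^'n. det A \<noteq> 0} matrix_inv"
    by (intro continuous_at_imp_continuous_on ballI differentiable_imp_continuous_within
        differentiable_matrix_inv) simp
  moreover have "continuous_on U F" "F ` U \<subseteq> {A. det A \<noteq> 0}"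
    using 0 assms(2) by auto
  ultimately have "continuous_on U (\<lambda>x. matrix_inv (F x))"
    by (rule continuous_on_compose2)
  then show ?case by simp
next
  case (Suc k)
  let ?W = "\<lambda>x. matrix_inv (F x)"
  have W: "Ck_on k ?W U"
    using Suc Ck_on_Suc_imp by blast
  show ?case
  proof (rule Ck_on_Suc_has_derivative[OF assms(1)])
    show "(?W has_derivative (\<lambda>v. - (?W x ** frechet_derivative F (at x) v ** ?W x))) (at x)"
      if "x \<in> U" for x
      using diff_chain_at[OF Ck_on_has_derivative[OF Suc.prems that]
          has_derivative_matrix_inv[OF assms(2)[OF that]]]
      by (simp add: o_def)
    show "Ck_on k (\<lambda>x. - (?W x ** frechet_derivative F (at x) v ** ?W x)) U" for v
      using Suc.prems
      by (intro Ck_on_linear_compose[OF bounded_linear_minus[OF bounded_linear_ident]]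
          Ck_on_bilinear[OF bounded_bilinear_matrix_mult] W assms(1)) simp
  qed
qed

lemma smooth_on_bounded_linear: "bounded_linear L \<Longrightarrow> open U \<Longrightarrow> smooth_on U L"
  by (simp add: smooth_on_def Ck_on_bounded_linear)

lemma smooth_on_has_derivative:
  assumes "smooth_on U f" "x \<in> U"
  shows "(f has_derivative frechet_derivative f (at x)) (at x)"
  using assms by (auto simp: smooth_on_def intro: Ck_on_has_derivative)

section \<open>Linear matrix differential equations\<close>

lemma constant_if_has_vector_derivative_0:
  assumes "\<And>t. (f has_vector_derivative 0) (at t)"
  shows "f s = f (t::real)"
proof -
  obtain c where "\<And>x. f x = c"
    using has_vector_derivative_zero_constant[of UNIV f] assms by auto
  then show ?thesis by simp
qed

lemma eq_if_has_vector_derivative_eq: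
  fixes f g :: "real \<Rightarrow> 'a::real_normed_vector"
  assumes "\<And>t. (f has_vector_derivative h t) (at t)" "\<And>t. (g has_vector_derivative h t) (at t)"
    and "f 0 = g 0"
  shows "f t = g t"
proof -
  have "((\<lambda>t. f t - g t) has_vector_derivative 0) (at t)" for t
    using has_vector_derivative_diff[OF assms(1,2)[of t]] by simp
  from constant_if_has_vector_derivative_0[OF this, of t 0] show ?thesis
    using assms(3) by simp
qed

lemma antiderivative_UNIV:
  fixes f :: "real \<Rightarrow> 'a::euclidean_space"
  assumes "continuous_on UNIV f"
  obtains F where "F 0 = 0" "\<And>t. (F has_vector_derivative f t) (at t)"
proof -
  obtain F where F: "\<And>t. (F has_vector_derivative f t) (at t)"
    using einterval_antiderivative[of "-\<infinity>" "\<infinity>" f] assms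
    by (auto simp: continuous_on_eq_continuous_at)
  show ?thesis
  proof (rule that)
    show "((\<lambda>t. F t - F 0) has_vector_derivative f t) (at t)" for t
      using has_vector_derivative_diff[OF F has_vector_derivative_const] by simp
  qed simp
qed

text \<open>The exponential series, taken entry by entry. Both multiplication orders are recorded:
  \<open>g t ** S\<close> is the left-invariant equation, while \<open>S ** g t\<close> is the form
  that keeps the flow inside \<open>Sp J\<close>.\<close>

lemma matrix_exponential:
  fixes S :: "real^'n^'n"
  obtains g :: "real \<Rightarrow> real^'n^'n" where "g 0 = mat 1"
    "\<And>t. (g has_vector_derivative S ** g t) (at t)"
    "\<And>t. (g has_vector_derivative g t ** S) (at t)"
proof -
  define P where "P n = (((**) S) ^^ n) (mat 1)" for n
  \<comment> \<open>The sum over all entries dominates each absolute row sum, so a single constant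
    gives the entrywise bound \<open>C ^ n\<close> on the powers of \<open>S\<close>.\<close>
  define C where "C = (\<Sum>i\<in>UNIV. \<Sum>j\<in>UNIV. \<bar>S $ i $ j\<bar>)"
  have P0: "P 0 = mat 1" and PS: "P (Suc n) = S ** P n" for n
    by (simp_all add: P_def)
  have PS': "P (Suc n) = P n ** S" for n
    by (induction n) (simp add: P0 PS, metis PS matrix_mul_assoc)
  have C0: "C \<ge> 0" unfolding C_def by (intro sum_nonneg) simp
  have bound: "\<bar>P n $ i $ j\<bar> \<le> C ^ n" for n i j
  proof (induction n arbitrary: i)
    case 0
    then show ?case by (simp add: P0 mat_def)
  next
    case (Suc n)
    have "\<bar>P (Suc n) $ i $ j\<bar> \<le> (\<Sum>k\<in>UNIV. \<bar>S $ i $ k\<bar> * \<bar>P n $ k $ j\<bar>)"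
      unfolding PS matrix_matrix_mult_def
      by (simp add: order_trans[OF sum_abs] abs_mult)
    also have "\<dots> \<le> (\<Sum>k\<in>UNIV. \<bar>S $ i $ k\<bar> * C ^ n)"
      by (intro sum_mono mult_left_mono Suc.IH) simp
    also have "\<dots> = (\<Sum>k\<in>UNIV. \<bar>S $ i $ k\<bar>) * C ^ n"
      by (simp add: sum_distrib_right)
    also have "\<dots> \<le> C * C ^ n"
      unfolding C_def
      by (intro mult_right_mono member_le_sum) (use C0 in \<open>auto intro: sum_nonneg simp: C_def\<close>)
    finally show ?case by simp
  qed
  define a where "a i j n = P n $ i $ j / fact n" for i j n
  have summ: "summable (\<lambda>n. a i j n * t ^ n)" for i j t
  proof (rule summable_comparison_test'[where N = 0])
    show "summable (\<lambda>n. inverse (fact n) * (C * \<bar>t\<bar>) ^ n)"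
      by (rule summable_exp)
    show "norm (a i j n * t ^ n) \<le> inverse (fact n) * (C * \<bar>t\<bar>) ^ n" for n
      using mult_right_mono[OF bound[of n i j], of "\<bar>t\<bar> ^ n / fact n"]
      by (simp add: a_def abs_mult power_abs power_mult_distrib field_simps)
  qed
  define g where "g t = (\<chi> i j. \<Sum>n. a i j n * t ^ n)" for t
  \<comment> \<open>Since \<open>Suc n / fact (Suc n) = 1 / fact n\<close>, termwise differentiation
    only raises the power of \<open>S\<close> by one.\<close>
  have diffs: "diffs (a i j) n = P (Suc n) $ i $ j / fact n" for i j n
    by (simp add: diffs_def a_def field_simps del: of_nat_Suc)
  have deriv: "((\<lambda>t. g t $ i $ j) has_field_derivative (\<Sum>n. P (Suc n) $ i $ j / fact n * t ^ n)) (at t)"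
    for i j t
    using termdiffs_strong_converges_everywhere[OF summ, of i j t] by (simp add: g_def diffs)
  have l: "(\<Sum>n. P (Suc n) $ i $ j / fact n * t ^ n) = (S ** g t) $ i $ j" for i j t
  proof -
    have "(S ** g t) $ i $ j = (\<Sum>k\<in>UNIV. \<Sum>n. S $ i $ k * (a k j n * t ^ n))"
      by (simp add: matrix_matrix_mult_def g_def suminf_mult summ)
    also have "\<dots> = (\<Sum>n. \<Sum>k\<in>UNIV. S $ i $ k * (a k j n * t ^ n))"
      by (rule suminf_sum[symmetric]) (intro summable_mult summ)
    finally show ?thesis
      by (simp add: PS matrix_matrix_mult_def a_def sum_divide_distrib sum_distrib_right mult.assoc)
  qed
  have r: "(\<Sum>n. P (Suc n) $ i $ j / fact n * t ^ n) = (g t ** S) $ i $ j" for i j t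
  proof -
    have "(g t ** S) $ i $ j = (\<Sum>k\<in>UNIV. \<Sum>n. S $ k $ j * (a i k n * t ^ n))"
      by (simp add: matrix_matrix_mult_def g_def suminf_mult summ mult.commute[of _ "S $ _ $ _"])
    also have "\<dots> = (\<Sum>n. \<Sum>k\<in>UNIV. S $ k $ j * (a i k n * t ^ n))"
      by (rule suminf_sum[symmetric]) (intro summable_mult summ)
    finally show ?thesis
      by (simp add: PS' matrix_matrix_mult_def a_def sum_divide_distrib sum_distrib_left mult_ac)
  qed
  show ?thesis
  proof
    show "g 0 = mat 1"
      by (simp add: g_def vec_eq_iff powser_zero) (simp add: a_def P0)
    show "(g has_vector_derivative S ** g t) (at t)" for t
      by (rule has_vector_derivative_matrixI) (use deriv l in simp)
    show "(g has_vector_derivative g t ** S) (at t)" for t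
      by (rule has_vector_derivative_matrixI) (use deriv r in simp)
  qed
qed

text \<open>With an integrating factor \<open>h\<close> solving \<open>h' = - S h\<close>, the
  product of any solution with \<open>h\<close> is constant; \<open>h\<close> can then be cancelled
  because it has an inverse.\<close>

lemma linear_matrix_ode_unique:
  fixes X Y :: "real \<Rightarrow> real^'n^'m" and S :: "real^'n^'n"
  assumes "\<And>t. (X has_vector_derivative X t ** S) (at t)"
    and "\<And>t. (Y has_vector_derivative Y t ** S) (at t)"
    and "X 0 = Y 0"
  shows "X t = Y t"
proof -
  obtain h where h: "h 0 = mat 1" "\<And>t. (h has_vector_derivative - S ** h t) (at t)"
    using matrix_exponential[of "- S" thesis] by blast
  \<comment> \<open>The row dimension of \<open>Z\<close> is left free: the claim serves
    \<open>X\<close> and \<open>Y\<close>, and also the square exponential \<open>e\<close>, for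
    which it says that \<open>h t\<close> is invertible.\<close>
  have const: "Z t ** h t = Z 0"
    if "\<And>t. (Z has_vector_derivative Z t ** S) (at t)" for Z :: "real \<Rightarrow> real^'n^'k" and t
  proof -
    have "((\<lambda>t. Z t ** h t) has_vector_derivative 0) (at t)" for t
      using matrix_mult.has_vector_derivative[OF that h(2), of t]
      by (simp add: matrix_linear matrix_mul_assoc)
    from constant_if_has_vector_derivative_0[OF this, of t 0] show ?thesis
      by (simp add: h(1))
  qed
  obtain e where e: "e 0 = mat 1" "\<And>t. (e has_vector_derivative e t ** S) (at t)"
    using matrix_exponential[of S thesis] by blast
  have "h t ** e t = mat 1"
    using const[OF e(2), of t] e(1) matrix_left_right_inverse by metis
  moreover have "X t ** h t = Y t ** h t"
    using const[OF assms(1)] const[OF assms(2)] assms(3) by simp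
  ultimately show ?thesis
    by (metis matrix_mul_assoc matrix_mul_rid)
qed

section \<open>The generalized Jacobi group\<close>

locale symplectic_form =
  fixes J :: "real^'n^'n"
  assumes invertible_J: "invertible J"
    and transpose_J: "transpose J = - J"
begin

abbreviation Ji :: "real^'n^'n" where "Ji \<equiv> matrix_inv J"

text \<open>The variants with a trailing \<open>X\<close> are rewrite rules for products nested to
  the right, the normal form produced by \<open>matrix_mul_assoc[symmetric]\<close>. The facts on
  \<open>Sp J\<close> and \<open>sp J\<close> come in the same two shapes.\<close>

lemma J_Ji: "J ** Ji = mat 1" "Ji ** J = mat 1" "J ** (Ji ** X) = X" "Ji ** (J ** X) = X"
  using matrix_inv_inverse[OF invertible_J] by (simp_all add: matrix_mul_assoc)

lemma transpose_Ji: "transpose Ji = - Ji"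
proof -
  have "J ** (- transpose Ji) = transpose (Ji ** J)"
    by (simp add: matrix_transpose_mul transpose_J matrix_linear)
  then have "Ji = - transpose Ji"
    by (intro matrix_inv_unique) (simp add: J_Ji)
  then show ?thesis by (metis minus_minus)
qed

section \<open>Identities in the symplectic group and its Lie algebra\<close>

lemma SpD:
  assumes "g \<in> Sp J"
  shows "transpose g ** (J ** g) = J" "transpose g ** (J ** (g ** X)) = J ** X"
  using assms by (simp_all add: Sp_def matrix_mul_assoc)

lemma matrix_inv_Sp:
  assumes "g \<in> Sp J"
  shows "matrix_inv g = Ji ** (transpose g ** J)"
proof -
  have "Ji ** (transpose g ** J) ** g = mat 1"
    by (simp add: matrix_mul_assoc[symmetric] SpD[OF assms] J_Ji)
  then show ?thesis
    using matrix_inv_unique matrix_left_right_inverse by blast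
qed

lemma Sp_inverse:
  assumes "g \<in> Sp J"
  shows "g ** matrix_inv g = mat 1" "matrix_inv g ** g = mat 1"
    "g ** (matrix_inv g ** X) = X" "matrix_inv g ** (g ** X) = X"
proof -
  have "Ji ** (transpose g ** J) ** g = mat 1"
    by (simp add: matrix_mul_assoc[symmetric] SpD[OF assms] J_Ji)
  then have "invertible g"
    unfolding invertible_left_inverse by blast
  from matrix_inv_inverse[OF this]
  show "g ** matrix_inv g = mat 1" "matrix_inv g ** g = mat 1"
    "g ** (matrix_inv g ** X) = X" "matrix_inv g ** (g ** X) = X"
    by (simp_all add: matrix_mul_assoc)
qed

lemma Sp_one: "mat 1 \<in> Sp J"
  by (simp add: Sp_def)

lemma Sp_mult:
  assumes "g \<in> Sp J" "h \<in> Sp J"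
  shows "g ** h \<in> Sp J"
proof -
  have "transpose (g ** h) ** (J ** (g ** h)) = J"
    by (simp add: matrix_transpose_mul matrix_mul_assoc[symmetric] SpD[OF assms(1)] SpD[OF assms(2)])
  then show ?thesis by (simp add: Sp_def matrix_mul_assoc)
qed

lemma Sp_transpose:
  assumes "g \<in> Sp J"
  shows "transpose g ** J = J ** matrix_inv g" "transpose g ** (J ** X) = J ** (matrix_inv g ** X)"
  by (simp_all add: matrix_inv_Sp[OF assms] J_Ji matrix_mul_assoc[symmetric])

lemma Sp_matrix_inv:
  assumes "g \<in> Sp J"
  shows "matrix_inv g \<in> Sp J"
proof -
  let ?h = "matrix_inv g"
  have "transpose ?h ** J ** ?h = transpose ?h ** (transpose g ** (J ** (g ** ?h)))"
    by (simp add: SpD[OF assms] matrix_mul_assoc[symmetric])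
  also have "\<dots> = transpose (g ** ?h) ** (J ** (g ** ?h))"
    by (simp only: matrix_transpose_mul matrix_mul_assoc)
  finally show ?thesis
    by (simp add: Sp_def Sp_inverse[OF assms])
qed

lemma transpose_matrix_inv_Sp:
  assumes "g \<in> Sp J"
  shows "transpose (matrix_inv g) ** J = J ** g" "transpose (matrix_inv g) ** (J ** X) = J ** (g ** X)"
proof -
  have "matrix_inv (matrix_inv g) = g"
    by (rule matrix_inv_unique) (rule Sp_inverse(2)[OF assms])
  then show "transpose (matrix_inv g) ** J = J ** g"
      "transpose (matrix_inv g) ** (J ** X) = J ** (g ** X)"
    using Sp_transpose[OF Sp_matrix_inv[OF assms]] by simp_all
qed

lemma spD:
  assumes "S \<in> sp J"
  shows "transpose S ** J = - (J ** S)" "transpose S ** (J ** X) = - (J ** (S ** X))"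
proof -
  show *: "transpose S ** J = - (J ** S)"
    using assms by (simp add: sp_def eq_neg_iff_add_eq_0)
  have "transpose S ** (J ** X) = (transpose S ** J) ** X"
    by (rule matrix_mul_assoc)
  then show "transpose S ** (J ** X) = - (J ** (S ** X))"
    by (simp add: * matrix_linear matrix_mul_assoc)
qed

text \<open>\<open>sym_part\<close> does not see a transpose, whereas transposing the product
  changes the sign of \<open>J\<close>. Hence the cocycle of the group law is antisymmetric and
  vanishes on the diagonal.\<close>

lemma sym_part_J_swap:
  "sym_part (transpose A ** (J ** B)) = - sym_part (transpose B ** (J ** A))"
proof -
  have "sym_part (transpose A ** (J ** B)) = sym_part (transpose (transpose A ** (J ** B)))"
    by simp
  also have "\<dots> = - sym_part (transpose B ** (J ** A))"
    unfolding matrix_transpose_mul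
    by (simp add: transpose_J matrix_linear matrix_mul_assoc[symmetric])
  finally show ?thesis .
qed

lemma sym_part_J_self: "sym_part (transpose A ** (J ** A)) = 0"
  using sym_part_J_swap[of A A] by (simp add: equation_minus_iff eq_neg_iff_add_eq_0 flip: scaleR_2)

text \<open>This is the cocycle identity: the extra term
  \<open>transpose (g ** A') ** J ** g ** g' ** A''\<close> loses both copies of \<open>g\<close> by
  the symplectic condition.\<close>

lemma jac_mult_assoc:
  assumes "fst a \<in> Sp J"
  shows "jac_mult J (jac_mult J a b) c = jac_mult J a (jac_mult J b c)"
  using assms
  by (cases a; cases b; cases c)
     (simp add: matrix_transpose_mul matrix_mul_assoc[symmetric] matrix_linear SpD scaleR_add_right)

lemma carrier_Jac [simp]: "(g, A, B) \<in> carrier (Jac J) \<longleftrightarrow> g \<in> Sp J"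
  by (simp add: Jac_def)

lemma mult_Jac [simp]: "a \<otimes>\<^bsub>Jac J\<^esub> b = jac_mult J a b"
  by (simp add: Jac_def)

lemma one_Jac [simp]: "\<one>\<^bsub>Jac J\<^esub> = (mat 1, 0, 0)"
  by (simp add: Jac_def)

lemma fst_carrier_Jac: "a \<in> carrier (Jac J) \<Longrightarrow> fst a \<in> Sp J"
  by (cases a) simp

lemma jac_mult_one [simp]: "jac_mult J (mat 1, 0, 0) a = a" "jac_mult J a (mat 1, 0, 0) = a"
  by (cases a, simp)+

text \<open>The quadratic term reduces to a multiple of
  \<open>sym_part (transpose A ** (J ** A))\<close>, which is zero; hence \<open>B\<close> is merely
  negated.\<close>

lemma jac_mult_left_inverse:
  assumes "g \<in> Sp J"
  shows "jac_mult J (matrix_inv g, - (matrix_inv g ** A), - B) (g, A, B) = (mat 1, 0, 0)"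
  by (simp add: Sp_inverse[OF assms] matrix_linear matrix_transpose_mul
      matrix_mul_assoc[symmetric] transpose_matrix_inv_Sp[OF assms] sym_part_J_self)

lemma group_Jac: "group (Jac J :: ('n, 'd::finite) jac monoid)"
proof (rule groupI)
  fix a b c :: "('n, 'd) jac"
  assume "a \<in> carrier (Jac J)"
  then show "a \<otimes>\<^bsub>Jac J\<^esub> b \<otimes>\<^bsub>Jac J\<^esub> c = a \<otimes>\<^bsub>Jac J\<^esub> (b \<otimes>\<^bsub>Jac J\<^esub> c)"
    by (simp add: jac_mult_assoc fst_carrier_Jac)
  show "\<one>\<^bsub>Jac J\<^esub> \<otimes>\<^bsub>Jac J\<^esub> a = a" by simp
  obtain g A B where a: "a = (g, A, B)" by (cases a)
  then have g: "g \<in> Sp J" using \<open>a \<in> carrier (Jac J)\<close> by simp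
  show "\<exists>b\<in>carrier (Jac J). b \<otimes>\<^bsub>Jac J\<^esub> a = \<one>\<^bsub>Jac J\<^esub>"
    by (rule bexI[of _ "(matrix_inv g, - (matrix_inv g ** A), - B)"])
       (simp_all only: a mult_Jac one_Jac carrier_Jac jac_mult_left_inverse[OF g] Sp_matrix_inv[OF g])
next
  fix a b :: "('n, 'd) jac"
  assume "a \<in> carrier (Jac J)" "b \<in> carrier (Jac J)"
  then show "a \<otimes>\<^bsub>Jac J\<^esub> b \<in> carrier (Jac J)"
    by (cases a; cases b) (simp add: Sp_mult)
qed (simp add: Sp_one)

lemma inv_Jac:
  assumes "g \<in> Sp J"
  shows "inv\<^bsub>Jac J\<^esub> (g, A, B) = (matrix_inv g, - (matrix_inv g ** A), - B)"
  by (rule group.inv_equality[OF group_Jac])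
     (use assms in \<open>simp_all only: mult_Jac one_Jac jac_mult_left_inverse carrier_Jac Sp_matrix_inv\<close>)

section \<open>One-parameter subgroups\<close>

text \<open>The derivative of left translation by \<open>a\<close>; it is the linear part of the affine map
  \<open>jac_mult J a\<close>.\<close>

definition jac_left :: "('n, 'd::finite) jac \<Rightarrow> ('n, 'd) jac \<Rightarrow> ('n, 'd) jac" where
  "jac_left a \<xi> = (fst a ** fst \<xi>, fst a ** fst (snd \<xi>),
     snd (snd \<xi>) + (1/2) *\<^sub>R sym_part (transpose (fst (snd a)) ** (J ** (fst a ** fst (snd \<xi>)))))"

lemma jac_left_one: "jac_left (mat 1, 0, 0) \<xi> = \<xi>"
  by (simp add: jac_left_def)

lemma bounded_linear_jac_left: "bounded_linear (jac_left a)"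
  unfolding linear_conv_bounded_linear[symmetric]
  by (rule linearI) (simp_all add: jac_left_def matrix_linear scaleR_add_right)

lemma jac_mult_eq_jac_left: "jac_mult J a x = (0, fst (snd a), snd (snd a)) + jac_left a x"
  by (cases a; cases x) (simp add: jac_left_def matrix_mul_assoc)

text \<open>Associativity of the group law, differentiated in the last factor. It says that left
  translates of solutions of the left-invariant equation are again solutions.\<close>

lemma jac_left_jac_mult:
  assumes "fst a \<in> Sp J"
  shows "jac_left (jac_mult J a x) \<xi> = jac_left a (jac_left x \<xi>)"
  using assms
  by (cases a; cases x)
     (simp add: jac_left_def matrix_transpose_mul matrix_mul_assoc[symmetric] matrix_linear SpD
       scaleR_add_right)

lemma has_vector_derivative_jac_mult:
  assumes "(c has_vector_derivative \<xi>) (at t)"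
  shows "((\<lambda>t. jac_mult J a (c t)) has_vector_derivative jac_left a \<xi>) (at t)"
  unfolding jac_mult_eq_jac_left
  using has_vector_derivative_add[OF has_vector_derivative_const
      bounded_linear.has_vector_derivative[OF bounded_linear_jac_left assms]]
  by simp

lemma has_vector_derivative_components:
  assumes "(c has_vector_derivative \<xi>) (at (t::real))"
  shows "((\<lambda>t. fst (c t)) has_vector_derivative fst \<xi>) (at t)"
    "((\<lambda>t. fst (snd (c t))) has_vector_derivative fst (snd \<xi>)) (at t)"
    "((\<lambda>t. snd (snd (c t))) has_vector_derivative snd (snd \<xi>)) (at t)"
  by (intro bounded_linear.has_vector_derivative[OF bounded_linear_fst]
      bounded_linear.has_vector_derivative[OF bounded_linear_snd] assms)+

lemma jac_ode_unique:
  assumes c: "\<And>t. (c has_vector_derivative jac_left (c t) \<xi>) (at t)"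
    and c': "\<And>t. (c' has_vector_derivative jac_left (c' t) \<xi>) (at t)"
    and "c 0 = c' 0"
  shows "c t = c' t"
proof -
  have 1: "fst (c t) = fst (c' t)" for t
    by (rule linear_matrix_ode_unique[of _ "fst \<xi>"])
       (use has_vector_derivative_components(1)[OF c] has_vector_derivative_components(1)[OF c']
          assms(3) in \<open>simp_all add: jac_left_def\<close>)
  have 2: "fst (snd (c t)) = fst (snd (c' t))" for t
    by (rule eq_if_has_vector_derivative_eq[where h = "\<lambda>t. fst (c t) ** fst (snd \<xi>)"])
       (use has_vector_derivative_components(2)[OF c] has_vector_derivative_components(2)[OF c']
          assms(3) 1 in \<open>simp_all add: jac_left_def\<close>)
  have "snd (snd (c t)) = snd (snd (c' t))"
    by (rule eq_if_has_vector_derivative_eq[where h = "\<lambda>t. snd (snd \<xi>) + (1/2) *\<^sub>R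
          sym_part (transpose (fst (snd (c t))) ** (J ** (fst (c t) ** fst (snd \<xi>))))"])
       (use has_vector_derivative_components(3)[OF c] has_vector_derivative_components(3)[OF c']
          assms(3) 1 2 in \<open>simp_all add: jac_left_def\<close>)
  with 1 2 show ?thesis
    by (simp add: prod_eq_iff)
qed

text \<open>The definition gives a derivative at 0 only; writing \<open>c x\<close> as
  \<open>c t\<close> times \<open>c (x - t)\<close> carries it to every \<open>t\<close>. The value
  \<open>c 0\<close> is the unit because it is idempotent.\<close>

lemma one_parameter_subgroup_ode:
  assumes "one_parameter_subgroup J \<xi> c"
  shows "c 0 = (mat 1, 0, 0)" "(c has_vector_derivative jac_left (c t) \<xi>) (at t)"
proof -
  have carr: "c t \<in> carrier (Jac J)" and add: "c (s + t) = c s \<otimes>\<^bsub>Jac J\<^esub> c t"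
    and deriv: "(c has_vector_derivative \<xi>) (at 0)" for s t
    using assms by (auto simp: one_parameter_subgroup_def)
  show "c 0 = (mat 1, 0, 0)"
    using add[of 0 0] group.l_cancel_one[OF group_Jac carr carr, of 0 0] by simp
  have "((\<lambda>x. x - t) has_vector_derivative 1) (at t)"
    by (auto intro!: derivative_eq_intros)
  moreover have "((\<lambda>h. jac_mult J (c t) (c h)) has_vector_derivative jac_left (c t) \<xi>) (at (t - t))"
    using has_vector_derivative_jac_mult[OF deriv] by simp
  ultimately have "((\<lambda>h. jac_mult J (c t) (c h)) \<circ> (\<lambda>x. x - t) has_vector_derivative 1 *\<^sub>R jac_left (c t) \<xi>) (at t)"
    by (rule vector_diff_chain_at)
  moreover have "jac_mult J (c t) (c (x - t)) = c x" for x
    using add[of t "x - t"] by simp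
  then have "(\<lambda>h. jac_mult J (c t) (c h)) \<circ> (\<lambda>x. x - t) = c"
    by (simp add: fun_eq_iff)
  ultimately show "(c has_vector_derivative jac_left (c t) \<xi>) (at t)"
    by simp
qed

lemma one_parameter_subgroup_unique:
  assumes "one_parameter_subgroup J \<xi> c" "one_parameter_subgroup J \<xi> c'"
  shows "c = c'"
  using jac_ode_unique[of c \<xi> c'] one_parameter_subgroup_ode assms by (metis ext)

lemma one_parameter_subgroup_exists:
  fixes \<xi> :: "('n, 'd::finite) jac"
  assumes "\<xi> \<in> jac_algebra J"
  shows "\<exists>c. one_parameter_subgroup J \<xi> c"
proof -
  obtain S A B where \<xi>: "\<xi> = (S, A, B)" by (cases \<xi>)
  with assms have S: "S \<in> sp J" by (simp add: jac_algebra_def)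
  obtain g where g0: "g 0 = mat 1"
    and gl: "\<And>t. (g has_vector_derivative S ** g t) (at t)"
    and gr: "\<And>t. (g has_vector_derivative g t ** S) (at t)"
    using matrix_exponential[of S thesis] by blast
  \<comment> \<open>For \<open>S\<close> in \<open>sp J\<close> the form \<open>J\<close> is
    conserved along the linear flow, so the flow starting at the identity stays symplectic.\<close>
  have "((\<lambda>t. transpose (g t) ** (J ** g t)) has_vector_derivative 0) (at t)" for t
    using matrix_mult.has_vector_derivative
      [OF bounded_linear.has_vector_derivative[OF bounded_linear_transpose gl[of t]]
        bounded_linear.has_vector_derivative[OF matrix_mult.bounded_linear_right[of J] gl[of t]]]
    by (simp add: matrix_transpose_mul matrix_mul_assoc[symmetric] spD[OF S] matrix_linear)
  from constant_if_has_vector_derivative_0[OF this, of _ 0] have Sp: "g t \<in> Sp J" for t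
    by (simp add: Sp_def g0 matrix_mul_assoc)
  have cont_g: "continuous_on UNIV g"
    using gl by (auto intro!: continuous_at_imp_continuous_on has_vector_derivative_continuous)
  obtain \<alpha> where \<alpha>0: "\<alpha> 0 = 0" and \<alpha>: "\<And>t. (\<alpha> has_vector_derivative g t ** A) (at t)"
    by (rule antiderivative_UNIV[of "\<lambda>t. g t ** A"])
       (use matrix_mult.continuous_on[OF cont_g continuous_on_const] in auto)
  have cont_\<alpha>: "continuous_on UNIV \<alpha>"
    using \<alpha> by (auto intro!: continuous_at_imp_continuous_on has_vector_derivative_continuous)
  have "continuous_on UNIV (\<lambda>t. B + (1/2) *\<^sub>R sym_part (transpose (\<alpha> t) ** (J ** (g t ** A))))"
    by (intro continuous_intros matrix_mult.continuous_on cont_g cont_\<alpha>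
        bounded_linear.continuous_on[OF bounded_linear_sym_part]
        bounded_linear.continuous_on[OF bounded_linear_transpose])
  then obtain \<beta> where \<beta>0: "\<beta> 0 = 0"
    and \<beta>: "\<And>t. (\<beta> has_vector_derivative B + (1/2) *\<^sub>R sym_part (transpose (\<alpha> t) ** (J ** (g t ** A)))) (at t)"
    by (rule antiderivative_UNIV) (rule that)
  define c where "c t = (g t, \<alpha> t, \<beta> t)" for t
  have c0: "c 0 = (mat 1, 0, 0)"
    by (simp add: c_def g0 \<alpha>0 \<beta>0)
  have c: "(c has_vector_derivative jac_left (c t) \<xi>) (at t)" for t
    using has_vector_derivative_Pair[OF gr has_vector_derivative_Pair[OF \<alpha> \<beta>], of t]
    by (simp add: c_def[abs_def] jac_left_def \<xi>)
  have carr: "c t \<in> carrier (Jac J)" for t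
    by (simp add: c_def Sp)
  \<comment> \<open>As functions of \<open>t\<close>, both sides solve the left-invariant equation
    and start at \<open>c s\<close>.\<close>
  have "c (s + t) = jac_mult J (c s) (c t)" for s t
  proof (rule jac_ode_unique)
    fix t
    have "((\<lambda>t. s + t) has_vector_derivative 1) (at t)"
      by (auto intro!: derivative_eq_intros)
    from vector_diff_chain_at[OF this c]
    show "((\<lambda>t. c (s + t)) has_vector_derivative jac_left (c (s + t)) \<xi>) (at t)"
      by (simp add: o_def)
    show "((\<lambda>t. jac_mult J (c s) (c t)) has_vector_derivative jac_left (jac_mult J (c s) (c t)) \<xi>) (at t)"
      using has_vector_derivative_jac_mult[OF c] by (simp add: jac_left_jac_mult fst_carrier_Jac carr)
  qed (simp add: c0)
  then show ?thesis
    using c[of 0] carr by (auto simp: one_parameter_subgroup_def c0 jac_left_one)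
qed

text \<open>\<open>jac_exp\<close> evaluates a curve at time 1, and \<open>c (t * s)\<close>, as a
  function of \<open>s\<close>, is the one-parameter subgroup of the rescaled generator; at
  \<open>s = 1\<close> it equals \<open>c t\<close>.\<close>

lemma jac_exp_curve:
  assumes "\<xi> \<in> jac_algebra J"
  obtains c where "one_parameter_subgroup J \<xi> c" "\<And>t. jac_exp J (t *\<^sub>R \<xi>) = c t"
proof -
  obtain c where c: "one_parameter_subgroup J \<xi> c"
    using one_parameter_subgroup_exists[OF assms] by blast
  have "jac_exp J (t *\<^sub>R \<xi>) = c t" for t
  proof -
    have "((\<lambda>s. t * s) has_vector_derivative t) (at 0)"
      by (auto intro!: derivative_eq_intros)
    from vector_diff_chain_at[OF this, of c \<xi>] c
    have "one_parameter_subgroup J (t *\<^sub>R \<xi>) (\<lambda>s. c (t * s))"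
      by (simp add: one_parameter_subgroup_def o_def distrib_left)
    then have "(THE c. one_parameter_subgroup J (t *\<^sub>R \<xi>) c) = (\<lambda>s. c (t * s))"
      using one_parameter_subgroup_unique by blast
    then show ?thesis by (simp add: jac_exp_def)
  qed
  with c show ?thesis by (rule that)
qed

section \<open>The action and its infinitesimal generators\<close>

text \<open>The cross term comes from \<open>transpose (g ** A')\<close>; moving
  \<open>transpose g\<close> past \<open>J\<close> turns it into \<open>matrix_inv g\<close> on the
  right, that is, the translation of \<open>b\<close> followed by the linear action of
  \<open>a\<close>.\<close>

lemma jac_action_mult:
  assumes "fst a \<in> Sp J" "fst b \<in> Sp J"
  shows "jac_action J (jac_mult J a b) p = jac_action J a (jac_action J b p)"
proof -
  obtain g A B where a: "a = (g, A, B)" by (cases a)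
  obtain g' A' B' where b: "b = (g', A', B')" by (cases b)
  obtain K M where p: "p = (K, M)" by (cases p)
  have g: "g \<in> Sp J" and g': "g' \<in> Sp J" using assms by (simp_all add: a b)
  have "matrix_inv (g ** g') = matrix_inv g' ** matrix_inv g"
    by (rule matrix_inv_unique) (simp add: matrix_mul_assoc[symmetric] Sp_inverse[OF g] Sp_inverse[OF g'])
  then show ?thesis
    by (simp add: a b p matrix_linear matrix_transpose_mul matrix_mul_assoc[symmetric]
        Sp_transpose[OF g])
qed

lemma jac_action_one: "jac_action J (mat 1, 0, 0) p = p"
proof -
  have "matrix_inv (mat 1 :: real^'n^'n) = mat 1"
    by (rule matrix_inv_unique) simp
  then show ?thesis by (cases p) simp
qed

lemma group_action_Jac: "group_action (Jac J :: ('n, 'd::finite) jac monoid) UNIV (jac_action J)"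
proof -
  let ?G = "Jac J :: ('n, 'd) jac monoid"
  have Bij: "jac_action J a \<in> Bij UNIV" if "a \<in> carrier ?G" for a
  proof -
    let ?b = "inv\<^bsub>?G\<^esub> a"
    have b: "?b \<in> carrier ?G" using that by (rule group.inv_closed[OF group_Jac])
    have "jac_mult J a ?b = (mat 1, 0, 0)" "jac_mult J ?b a = (mat 1, 0, 0)"
      using group.r_inv[OF group_Jac that] group.l_inv[OF group_Jac that] by simp_all
    then have "jac_action J a (jac_action J ?b p) = p" "jac_action J ?b (jac_action J a p) = p" for p
      using jac_action_mult[of a ?b p] jac_action_mult[of ?b a p] that b
      by (simp_all add: fst_carrier_Jac jac_action_one)
    then have "bij (jac_action J a)"
      by (metis bijI')
    then show ?thesis by (simp add: Bij_def)
  qed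
  have "jac_action J \<in> hom ?G (BijGroup UNIV)"
    by (intro homI)
       (auto simp: BijGroup_def Bij compose_def jac_action_mult fst_carrier_Jac fun_eq_iff)
  then show ?thesis
    unfolding group_action_def group_hom_def group_hom_axioms_def
    using group_Jac group_BijGroup by blast
qed

text \<open>Written this way, the action is visibly affine in \<open>(g, A)\<close>, so it can be differentiated in the group
  variable.\<close>

lemma jac_action_eq:
  assumes "g \<in> Sp J"
  shows "jac_action J (g, A, B) (K, M) =
    (K ** (Ji ** (transpose g ** J)) - mat_of M ** (transpose A ** J), M)"
  by (simp add: matrix_inv_Sp[OF assms] matrix_mul_assoc)

lemma jac_generator_eq:
  fixes A :: "real^('d::finite)^'n"
  assumes "(S, A, B) \<in> jac_algebra J"
  shows "jac_generator J (S, A, B) (K, M) = (- (K ** S) - mat_of M ** (transpose A ** J), 0)"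
proof -
  have S: "S \<in> sp J" using assms by (simp add: jac_algebra_def)
  obtain c where c: "one_parameter_subgroup J (S, A, B) c"
    and exp: "\<And>t. jac_exp J (t *\<^sub>R (S, A, B)) = c t"
    using jac_exp_curve[OF assms] by blast
  let ?L = "\<lambda>x :: ('n, 'd) jac.
    K ** (Ji ** (transpose (fst x) ** J)) - mat_of M ** (transpose (fst (snd x)) ** J)"
  have "bounded_linear ?L"
    unfolding linear_conv_bounded_linear[symmetric]
    by (rule linearI) (simp_all add: matrix_linear scaleR_diff_right)
  moreover have "(c has_vector_derivative (S, A, B)) (at 0)"
    using c by (simp add: one_parameter_subgroup_def)
  ultimately have "((\<lambda>t. ?L (c t)) has_vector_derivative ?L (S, A, B)) (at 0)"
    by (rule bounded_linear.has_vector_derivative)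
  then have "((\<lambda>t. (?L (c t), M)) has_vector_derivative (?L (S, A, B), 0)) (at 0)"
    by (intro has_vector_derivative_Pair has_vector_derivative_const)
  moreover have "jac_action J (c t) (K, M) = (?L (c t), M)" for t
  proof -
    have "c t \<in> carrier (Jac J)" using c by (simp add: one_parameter_subgroup_def)
    then show ?thesis
      by (cases "c t") (simp add: jac_action_eq del: jac_action.simps)
  qed
  ultimately have "jac_generator J (S, A, B) (K, M) = (?L (S, A, B), 0)"
    unfolding jac_generator_def exp by (simp add: vector_derivative_at)
  then show ?thesis
    by (simp add: spD[OF S] matrix_linear J_Ji)
qed

section \<open>The coadjoint action\<close>

lemma jac_Ad_inv:
  fixes A A' :: "real^('d::finite)^'n"
  assumes "(S, A', B') \<in> jac_algebra J" "g \<in> Sp J"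
  shows "jac_Ad J (inv\<^bsub>Jac J\<^esub> (g, A, B)) (S, A', B') =
    (matrix_inv g ** (S ** g), matrix_inv g ** (A' + S ** A),
      B' - sym_part (transpose A ** (J ** A')) - (1/2) *\<^sub>R sym_part (transpose A ** (J ** (S ** A))))"
proof -
  let ?h = "matrix_inv g"
  obtain c where c: "one_parameter_subgroup J (S, A', B') c"
    and exp: "\<And>t. jac_exp J (t *\<^sub>R (S, A', B')) = c t"
    using jac_exp_curve[OF assms(1)] by blast
  define \<gamma> where "\<gamma> t = fst (c t)" for t
  define \<alpha> where "\<alpha> t = fst (snd (c t))" for t
  define \<beta> where "\<beta> t = snd (snd (c t))" for t
  have ct: "c t = (\<gamma> t, \<alpha> t, \<beta> t)" for t
    by (simp add: \<gamma>_def \<alpha>_def \<beta>_def)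
  have at0: "\<gamma> 0 = mat 1" "\<alpha> 0 = 0"
    using one_parameter_subgroup_ode(1)[OF c] by (simp_all add: \<gamma>_def \<alpha>_def)
  have deriv: "(c has_vector_derivative (S, A', B')) (at 0)"
    using c by (simp add: one_parameter_subgroup_def)
  have d: "(\<gamma> has_vector_derivative S) (at 0)" "(\<alpha> has_vector_derivative A') (at 0)"
      "(\<beta> has_vector_derivative B') (at 0)"
    using has_vector_derivative_components[OF deriv] unfolding \<gamma>_def \<alpha>_def \<beta>_def by simp_all
  have inv_inv: "inv\<^bsub>Jac J\<^esub> (inv\<^bsub>Jac J\<^esub> (g, A, B)) = (g, A, B)"
    by (rule group.inv_inv[OF group_Jac]) (simp add: assms(2))
  \<comment> \<open>Conjugation written out in the coordinates of \<open>x\<close>. Apart from the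
    constant \<open>- ?h ** A\<close> and the last term, which is bilinear, it is linear in
    \<open>x\<close>; the bilinear term is differentiated separately at
    \<open>\<alpha> 0 = 0\<close>.\<close>
  define F where "F x = (?h ** (fst x ** g), ?h ** (fst (snd x) + fst x ** A) - ?h ** A,
      snd (snd x) - (1/2) *\<^sub>R sym_part (transpose A ** (J ** fst (snd x)))
        - (1/2) *\<^sub>R sym_part (transpose A ** (J ** (fst x ** A)))
        + (1/2) *\<^sub>R sym_part (transpose (fst (snd x)) ** (J ** (fst x ** A))))"
    for x :: "('n, 'd) jac"
  have prod: "inv\<^bsub>Jac J\<^esub> (g, A, B) \<otimes>\<^bsub>Jac J\<^esub> c t \<otimes>\<^bsub>Jac J\<^esub> inv\<^bsub>Jac J\<^esub> (inv\<^bsub>Jac J\<^esub> (g, A, B)) = F (c t)" for t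
    unfolding inv_inv
    by (simp add: inv_Jac[OF assms(2)] F_def ct matrix_linear matrix_transpose_mul
        matrix_mul_assoc[symmetric] transpose_matrix_inv_Sp[OF assms(2)] Sp_inverse[OF assms(2)]
        scaleR_add_right scaleR_diff_right)
  let ?L = "\<lambda>x :: ('n, 'd) jac. (?h ** (fst x ** g), ?h ** (fst (snd x) + fst x ** A),
      snd (snd x) - (1/2) *\<^sub>R sym_part (transpose A ** (J ** fst (snd x)))
        - (1/2) *\<^sub>R sym_part (transpose A ** (J ** (fst x ** A))))"
  have "bounded_linear ?L"
    unfolding linear_conv_bounded_linear[symmetric]
    by (rule linearI) (simp_all add: matrix_linear scaleR_diff_right scaleR_add_right)
  from bounded_linear.has_vector_derivative[OF this deriv]
  have L: "((\<lambda>t. ?L (c t)) has_vector_derivative ?L (S, A', B')) (at 0)" .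
  have "((\<lambda>t. transpose (\<alpha> t) ** (J ** (\<gamma> t ** A))) has_vector_derivative
      transpose (\<alpha> 0) ** (J ** (S ** A)) + transpose A' ** (J ** (\<gamma> 0 ** A))) (at 0)"
    by (intro matrix_mult.has_vector_derivative
        bounded_linear.has_vector_derivative[OF bounded_linear_transpose]
        bounded_linear.has_vector_derivative[OF matrix_mult.bounded_linear_right]
        bounded_linear.has_vector_derivative[OF matrix_mult.bounded_linear_left] d)
  then have "((\<lambda>t. (1/2) *\<^sub>R sym_part (transpose (\<alpha> t) ** (J ** (\<gamma> t ** A)))) has_vector_derivative
      (1/2) *\<^sub>R sym_part (transpose A' ** (J ** A))) (at 0)"
    unfolding at0
    by (intro bounded_linear.has_vector_derivative[OF bounded_linear_scaleR_right]
        bounded_linear.has_vector_derivative[OF bounded_linear_sym_part]) simp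
  from has_vector_derivative_add[OF L has_vector_derivative_Pair[OF has_vector_derivative_const
        has_vector_derivative_Pair[OF has_vector_derivative_const this]], of 0 "- (?h ** A)"]
  have "((\<lambda>t. F (c t)) has_vector_derivative ?L (S, A', B') +
      (0, 0, (1/2) *\<^sub>R sym_part (transpose A' ** (J ** A)))) (at 0)"
    by (simp add: F_def ct)
  then have "jac_Ad J (inv\<^bsub>Jac J\<^esub> (g, A, B)) (S, A', B') = ?L (S, A', B') +
      (0, 0, (1/2) *\<^sub>R sym_part (transpose A' ** (J ** A)))"
    unfolding jac_Ad_def exp prod by (rule vector_derivative_at)
  \<comment> \<open>By antisymmetry this half joins the one already in \<open>?L\<close>, giving
    coefficient 1 to the term mixing \<open>A\<close> and \<open>A'\<close>.\<close>
  also have "(1/2) *\<^sub>R sym_part (transpose A' ** (J ** A)) =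
      - ((1/2) *\<^sub>R sym_part (transpose A ** (J ** A')))"
    by (simp add: sym_part_J_swap[of A' A])
  finally show ?thesis
    by (simp add: algebra_simps flip: scaleR_add_left)
qed

text \<open>Right multiplication by \<open>Ji\<close> takes \<open>sp J\<close> to symmetric
  matrices, and left multiplication by \<open>Ji\<close> takes symmetric matrices to
  \<open>sp J\<close>. With \<open>Z = (X - X') ** Ji\<close> the admissible test element
  \<open>Ji ** Z\<close> turns the pairing into the squared norm of \<open>Z\<close>.\<close>

lemma jac_pairing_nondegenerate:
  assumes \<mu>: "\<mu> \<in> jac_dual_space J" and \<nu>: "\<nu> \<in> jac_dual_space J"
    and eq: "\<And>\<xi>. \<xi> \<in> jac_algebra J \<Longrightarrow> jac_pairing \<mu> \<xi> = jac_pairing \<nu> \<xi>"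
  shows "\<mu> = \<nu>"
proof -
  obtain X K M where m: "\<mu> = (X, K, M)" by (cases \<mu>)
  obtain X' K' M' where n: "\<nu> = (X', K', M')" by (cases \<nu>)
  have "X \<in> sp J" "X' \<in> sp J" using \<mu> \<nu> by (auto simp: m n jac_dual_space_def)
  then have Y: "transpose (X - X') ** J = - (J ** (X - X'))"
    using spD(1) by (simp add: matrix_linear)
  define Z where "Z = (X - X') ** Ji"
  have tX: "transpose (X - X') = - (J ** Z)"
    using arg_cong[OF Y, of "\<lambda>W. W ** Ji"] by (simp add: Z_def matrix_linear J_Ji matrix_mul_assoc[symmetric])
  have "transpose Z = transpose Ji ** transpose (X - X')"
    by (simp only: Z_def matrix_transpose_mul)
  then have tZ: "transpose Z = Z"
    unfolding tX transpose_Ji by (simp add: matrix_mult_linear J_Ji)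
  have "Ji ** Z \<in> sp J"
    by (simp add: sp_def matrix_transpose_mul transpose_Ji matrix_linear tZ J_Ji
        matrix_mul_assoc[symmetric])
  then have "jac_pairing \<mu> (Ji ** Z, 0, 0) = jac_pairing \<nu> (Ji ** Z, 0, 0)"
    by (intro eq) (simp add: jac_algebra_def)
  then have "trace ((X - X') ** (Ji ** Z)) = 0"
    by (simp add: m n matrix_linear zero_sym_mat.rep_eq)
  then have "trace (Z ** transpose Z) = 0"
    by (simp add: tZ) (simp add: Z_def matrix_mul_assoc)
  then have "Z = 0"
    by (simp add: trace_mult_transpose_eq_0_iff)
  then have "(X - X') ** Ji ** J = 0"
    by (simp add: Z_def)
  then have X: "X = X'"
    by (simp add: J_Ji matrix_mul_assoc[symmetric])
  have "(0, transpose (K - K'), 0) \<in> jac_algebra J"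
    by (simp add: jac_algebra_def sp_def)
  from eq[OF this] have "trace ((K - K') ** transpose (K - K')) = 0"
    by (simp add: m n matrix_linear zero_sym_mat.rep_eq algebra_simps)
  then have K: "K = K'"
    unfolding trace_mult_transpose_eq_0_iff by simp
  have "(0, 0, M - M') \<in> jac_algebra J"
    by (simp add: jac_algebra_def sp_def)
  from eq[OF this] have "trace (mat_of (M - M') ** transpose (mat_of (M - M'))) = 0"
    by (simp add: m n matrix_linear algebra_simps)
  then have "mat_of (M - M') = mat_of 0"
    unfolding trace_mult_transpose_eq_0_iff by (simp add: zero_sym_mat.rep_eq)
  then have "M = M'"
    by (simp add: mat_of_inject)
  with X K show ?thesis by (simp add: m n)
qed

lemma jac_Ad_star_inv_eq:
  fixes \<mu> \<nu> :: "('n, 'd::finite) jac_dual"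
  assumes "\<nu> \<in> jac_dual_space J"
    and "\<And>\<xi>. \<xi> \<in> jac_algebra J \<Longrightarrow> jac_pairing \<nu> \<xi> = jac_pairing \<mu> (jac_Ad J a \<xi>)"
  shows "jac_Ad_star J a \<mu> = \<nu>"
  unfolding jac_Ad_star_def
  by (rule the_equality) (use assms in \<open>auto intro!: jac_pairing_nondegenerate\<close>)

section \<open>Equivariance\<close>

lemma transpose_inv_mat_of:
  assumes "det (mat_of M) \<noteq> 0"
  shows "transpose (matrix_inv (mat_of M)) = matrix_inv (mat_of M)"
proof -
  have "matrix_inv (mat_of M) ** mat_of M = mat 1"
    using assms by (simp add: matrix_inv_inverse invertible_det_nz)
  then have "transpose (matrix_inv (mat_of M) ** mat_of M) = mat 1"
    by simp
  then have "mat_of M ** transpose (matrix_inv (mat_of M)) = mat 1"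
    by (simp add: matrix_transpose_mul)
  then show ?thesis
    using matrix_inv_unique by metis
qed

text \<open>The first component is \<open>Ji\<close> times a symmetric matrix, and such products lie
  in \<open>sp J\<close>.\<close>

lemma Psi_in_jac_dual_space:
  assumes "p \<in> heis_dual_reg"
  shows "Psi J p \<in> jac_dual_space J"
  using assms
  by (cases p)
     (simp add: jac_dual_space_def sp_def heis_dual_reg_def matrix_linear matrix_transpose_mul
       transpose_inv_mat_of transpose_Ji matrix_mul_assoc[symmetric] J_Ji)

text \<open>Equivariance tested on one Lie algebra element, with the adjoint action in explicit
  form. The transformed quadratic form splits into a term quadratic in \<open>K\<close>, two cross
  terms and one term free of \<open>K\<close>. Paired with \<open>S\<close>, the cross terms
  coincide and absorb the factor 1/2; the last term keeps it and matches the \<open>S ** A\<close>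
  correction of the adjoint action.\<close>

lemma jac_pairing_Psi_action:
  fixes A A' :: "real^('d::finite)^'n"
  assumes g: "g \<in> Sp J" and S: "S \<in> sp J" and M: "det (mat_of M) \<noteq> 0"
  shows "jac_pairing (Psi J (jac_action J (g, A, B) (K, M))) (S, A', B') =
    jac_pairing (Psi J (K, M))
      (matrix_inv g ** (S ** g), matrix_inv g ** (A' + S ** A),
        B' - sym_part (transpose A ** (J ** A')) - (1/2) *\<^sub>R sym_part (transpose A ** (J ** (S ** A))))"
proof -
  let ?h = "matrix_inv g" and ?M = "mat_of M" and ?N = "matrix_inv (mat_of M)"
  let ?L = "K ** ?h - ?M ** (transpose A ** J)"
  have MN: "?M ** (?N ** X) = X" "?N ** (?M ** X) = X" for X :: "real^'a^'d"
    using M by (simp_all add: matrix_mul_assoc matrix_inv_inverse invertible_det_nz)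
  have JiT: "Ji ** (transpose ?h ** X) = g ** (Ji ** X)" for X :: "real^'a^'n"
  proof -
    have "transpose ?h ** (J ** (Ji ** X)) = J ** (g ** (Ji ** X))"
      by (rule transpose_matrix_inv_Sp(2)[OF g])
    then show ?thesis by (simp add: J_Ji)
  qed
  have quad: "Ji ** (transpose ?L ** (?N ** ?L)) =
      g ** (Ji ** (transpose K ** (?N ** (K ** ?h)))) + A ** (K ** ?h)
      - g ** (Ji ** (transpose K ** (transpose A ** J))) - A ** (?M ** (transpose A ** J))"
    by (simp add: matrix_linear matrix_transpose_mul transpose_J matrix_mul_assoc[symmetric]
        JiT MN J_Ji)
  have t1: "trace (g ** (Ji ** (transpose K ** (?N ** (K ** ?h)))) ** S) =
      trace (Ji ** (transpose K ** (?N ** K)) ** (?h ** (S ** g)))"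
    using trace_mul_sym[of g "Ji ** (transpose K ** (?N ** (K ** (?h ** S))))"]
    by (simp add: matrix_mul_assoc[symmetric])
  have t2: "trace (A ** (K ** ?h) ** S) = trace (K ** (?h ** (S ** A)))"
    using trace_mul_sym[of A "K ** (?h ** S)"] by (simp add: matrix_mul_assoc[symmetric])
  \<comment> \<open>Transposition reverses the product and \<open>S\<close> in \<open>sp J\<close>
    contributes a sign; this is what identifies the second cross term with the first.\<close>
  have t3: "trace (g ** (Ji ** (transpose K ** (transpose A ** J))) ** S) =
      - trace (K ** (?h ** (S ** A)))"
  proof -
    have "trace (g ** (Ji ** (transpose K ** (transpose A ** J))) ** S) =
        trace (transpose (g ** (Ji ** (transpose K ** (transpose A ** J))) ** S))"
      by (simp only: trace_transpose)
    also have "transpose (g ** (Ji ** (transpose K ** (transpose A ** J))) ** S) =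
        - (J ** (S ** (A ** (K ** (Ji ** transpose g)))))"
      by (simp add: matrix_transpose_mul transpose_J transpose_Ji matrix_linear
          matrix_mul_assoc[symmetric] spD[OF S])
    also have "trace \<dots> = - trace (J ** (S ** (A ** (K ** (Ji ** transpose g)))))"
      by (simp add: matrix_linear)
    also have "trace (J ** (S ** (A ** (K ** (Ji ** transpose g))))) =
        trace (K ** (Ji ** (transpose g ** J)) ** (S ** A))"
      using trace_mul_sym[of "J ** (S ** A)" "K ** (Ji ** transpose g)"]
        trace_mul_sym[of J "S ** (A ** (K ** (Ji ** transpose g)))"]
        trace_mul_sym[of "S ** A" "K ** (Ji ** (transpose g ** J))"]
      by (simp add: matrix_mul_assoc[symmetric])
    finally show ?thesis
      by (simp add: matrix_inv_Sp[OF g] matrix_mul_assoc[symmetric])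
  qed
  have t4: "trace (A ** (?M ** (transpose A ** J)) ** S) = trace (?M ** (transpose A ** (J ** (S ** A))))"
    using trace_mul_sym[of A "?M ** (transpose A ** (J ** S))"] by (simp add: matrix_mul_assoc[symmetric])
  have "jac_pairing (Psi J (jac_action J (g, A, B) (K, M))) (S, A', B') =
      1/2 * trace (Ji ** (transpose ?L ** (?N ** ?L)) ** S) + trace (?L ** A') + trace (?M ** mat_of B')"
    by (simp add: matrix_mul_assoc matrix_mult.scaleR_left linear_scale[OF bounded_linear_trace[THEN bounded_linear.linear]])
  also have "trace (Ji ** (transpose ?L ** (?N ** ?L)) ** S) =
      trace (Ji ** (transpose K ** (?N ** K)) ** (?h ** (S ** g)))
      + 2 * trace (K ** (?h ** (S ** A))) - trace (?M ** (transpose A ** (J ** (S ** A))))"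
    unfolding quad matrix_mult.add_left matrix_mult.diff_left trace_add trace_sub t1 t2 t3 t4 by simp
  finally show ?thesis
    by (simp add: matrix_linear trace_mat_of_sym_part matrix_mul_assoc[symmetric])
qed

lemma is_equivariant_Psi: "is_equivariant J heis_dual_reg (Psi J :: ('n, 'd::finite) heis_dual \<Rightarrow> _)"
  unfolding is_equivariant_def
proof (intro ballI)
  fix a :: "('n, 'd) jac" and p :: "('n, 'd) heis_dual"
  assume a: "a \<in> carrier (Jac J)" and p: "p \<in> heis_dual_reg"
  obtain g A B where a_eq: "a = (g, A, B)" by (cases a)
  obtain K M where p_eq: "p = (K, M)" by (cases p)
  have g: "g \<in> Sp J" and M: "det (mat_of M) \<noteq> 0"
    using a p by (simp_all add: a_eq p_eq heis_dual_reg_def)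
  have "jac_Ad_star J (inv\<^bsub>Jac J\<^esub> a) (Psi J p) = Psi J (jac_action J a p)"
  proof (rule jac_Ad_star_inv_eq)
    show "Psi J (jac_action J a p) \<in> jac_dual_space J"
      by (rule Psi_in_jac_dual_space) (simp add: a_eq p_eq heis_dual_reg_def M)
    fix \<xi> :: "('n, 'd) jac" assume \<xi>: "\<xi> \<in> jac_algebra J"
    obtain S A' B' where \<xi>_eq: "\<xi> = (S, A', B')" by (cases \<xi>)
    have S: "S \<in> sp J" using \<xi> by (simp add: \<xi>_eq jac_algebra_def)
    show "jac_pairing (Psi J (jac_action J a p)) \<xi> = jac_pairing (Psi J p) (jac_Ad J (inv\<^bsub>Jac J\<^esub> a) \<xi>)"
      unfolding a_eq p_eq \<xi>_eq jac_pairing_Psi_action[OF g S M] jac_Ad_inv[OF \<xi>[unfolded \<xi>_eq] g] ..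
  qed
  then show "Psi J (jac_action J a p) = jac_Ad_star J (inv\<^bsub>Jac J\<^esub> a) (Psi J p)" ..
qed

end

section \<open>The Lie--Poisson bracket and the momentum identity\<close>

lemma inner_eq_trace: "inner A B = trace (transpose A ** B)" for A B :: "real^'n^'m"
proof -
  have "inner A B = (\<Sum>i\<in>UNIV. \<Sum>j\<in>UNIV. A $ i $ j * B $ i $ j)"
    by (simp add: inner_vec_def)
  also have "\<dots> = (\<Sum>j\<in>UNIV. \<Sum>i\<in>UNIV. A $ i $ j * B $ i $ j)"
    by (rule sum.swap)
  finally show ?thesis
    by (simp add: trace_def matrix_matrix_mult_def transpose_def)
qed

lemma partial_K_eqI:
  assumes f: "(f has_derivative f') (at p)" and D: "\<And>\<delta>. f' (\<delta>, 0) = trace (D ** \<delta>)"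
  shows "partial_K f p = D"
proof -
  have f'_eq: "frechet_derivative f (at p) = f'"
    using frechet_derivative_at[OF f] by simp
  have uniq: "E = D" if "\<forall>\<delta>. f' (\<delta>, 0) = trace (E ** \<delta>)" for E
  proof -
    have "trace ((E - D) ** transpose (E - D)) = 0"
      using that D[of "transpose (E - D)"] by (simp add: matrix_mult_linear trace_sub)
    then show ?thesis unfolding trace_mult_transpose_eq_0_iff by simp
  qed
  show ?thesis
    unfolding partial_K_def f'_eq by (rule the_equality) (simp add: D, rule uniq)
qed

text \<open>Existence of the gradient: the adjoint at 1 is the Riesz representative of the
  functional, and its transpose converts the inner product into the trace form.\<close>

lemma partial_K_works:
  fixes f :: "('n::finite, 'd::finite) heis_dual \<Rightarrow> real"
  assumes f: "(f has_derivative f') (at p)"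
  shows "f' (\<delta>, 0) = trace (partial_K f p ** \<delta>)"
proof -
  let ?\<phi> = "\<lambda>\<delta>. f' (\<delta>, 0)"
  have "bounded_linear f'"
    using f by (rule has_derivative_bounded_linear)
  then have lin: "linear ?\<phi>"
    by (intro bounded_linear.linear bounded_linear_compose[of f' "\<lambda>\<delta>. (\<delta>, 0)"]
        bounded_linear_Pair bounded_linear_ident bounded_linear_zero)
  have *: "?\<phi> \<delta> = trace (transpose (adjoint ?\<phi> 1) ** \<delta>)" for \<delta>
    using adjoint_works[OF lin, of \<delta> 1] by (simp add: inner_commute flip: inner_eq_trace)
  then have "partial_K f p = transpose (adjoint ?\<phi> 1)"
    by (rule partial_K_eqI[OF f])
  then show ?thesis
    by (simp only: *[symmetric])
qed

lemma open_heis_dual_reg: "open (heis_dual_reg :: ('n::finite, 'd::finite) heis_dual set)"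
proof -
  have "bounded_linear (\<lambda>p :: ('n, 'd) heis_dual. mat_of (snd p))"
    by (rule bounded_linear_compose[OF bounded_linear_mat_of bounded_linear_snd])
  then have "continuous_on UNIV (\<lambda>p :: ('n, 'd) heis_dual. mat_of (snd p))"
    by (rule linear_continuous_on)
  from open_vimage[OF open_det_nonzero this]
  have "open {p :: ('n, 'd) heis_dual. det (mat_of (snd p)) \<noteq> 0}"
    by (simp add: vimage_def)
  also have "{p :: ('n, 'd) heis_dual. det (mat_of (snd p)) \<noteq> 0} = heis_dual_reg"
    by (auto simp: heis_dual_reg_def)
  finally show ?thesis .
qed

section \<open>Invariance of the bracket and the Hamiltonian form of the generators\<close>

context symplectic_form
begin

text \<open>For a fixed group element even the translation of \<open>K\<close> is linear, since its
  amount is linear in \<open>M\<close>. Smoothness and the chain rule are then immediate.\<close>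

lemma bounded_linear_jac_action: "bounded_linear (jac_action J a)"
  unfolding linear_conv_bounded_linear[symmetric]
  by (cases a, rule linearI) (auto simp: matrix_linear scaleR_diff_right)

text \<open>With \<open>M\<close> fixed, the action changes \<open>K\<close> by right multiplication
  with \<open>matrix_inv g\<close> and a translation, so gradients are multiplied on the left by
  this symplectic matrix. It drops out around \<open>J\<close>, and the sign is a common
  factor.\<close>

lemma lie_poisson_compose_jac_action:
  fixes a :: "('n, 'd::finite) jac"
  assumes a: "a \<in> carrier (Jac J)"
    and f: "f differentiable at (jac_action J a p)" and h: "h differentiable at (jac_action J a p)"
  shows "lie_poisson \<sigma> J (f \<circ> jac_action J a) (h \<circ> jac_action J a) p =
    lie_poisson \<sigma> J f h (jac_action J a p)"
proof -
  obtain g A B where a_eq: "a = (g, A, B)" by (cases a)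
  have g: "g \<in> Sp J" using a by (simp add: a_eq)
  have partial: "partial_K (f \<circ> jac_action J a) p = matrix_inv g ** partial_K f (jac_action J a p)"
    if df: "f differentiable at (jac_action J a p)" for f :: "('n, 'd) heis_dual \<Rightarrow> real"
  proof -
    obtain f' where f': "(f has_derivative f') (at (jac_action J a p))"
      using df unfolding differentiable_def by blast
    show ?thesis
    proof (rule partial_K_eqI)
      show "(f \<circ> jac_action J a has_derivative f' \<circ> jac_action J a) (at p)"
        by (rule diff_chain_at[OF bounded_linear_imp_has_derivative[OF bounded_linear_jac_action] f'])
      show "(f' \<circ> jac_action J a) (\<delta>, 0) = trace (matrix_inv g ** partial_K f (jac_action J a p) ** \<delta>)" for \<delta>
        using partial_K_works[OF f', of "\<delta> ** matrix_inv g"]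
          trace_mul_sym[of "matrix_inv g" "partial_K f (jac_action J a p) ** \<delta>"]
        by (simp add: a_eq zero_sym_mat.rep_eq matrix_mul_assoc[symmetric])
    qed
  qed
  have "snd (jac_action J a p) = snd p"
    by (cases p) (simp add: a_eq)
  then show ?thesis
    by (simp add: lie_poisson_def partial[OF f] partial[OF h] matrix_transpose_mul
        matrix_mul_assoc[symmetric] transpose_matrix_inv_Sp[OF g] Sp_inverse[OF g])
qed

lemma poisson_map_jac_action:
  fixes a :: "('n, 'd::finite) jac"
  assumes "a \<in> carrier (Jac J)"
  shows "poisson_map (lie_poisson \<sigma> J) UNIV (jac_action J a)"
proof -
  have "f differentiable at p" if "smooth_on UNIV f" for f :: "('n, 'd) heis_dual \<Rightarrow> real" and p
    using smooth_on_has_derivative[OF that UNIV_I] by (rule differentiableI)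
  then show ?thesis
    by (simp add: poisson_map_def smooth_on_bounded_linear bounded_linear_jac_action
        lie_poisson_compose_jac_action[OF assms])
qed

lemma smooth_on_Psi: "smooth_on heis_dual_reg (Psi J :: ('n, 'd::finite) heis_dual \<Rightarrow> _)"
proof -
  let ?U = "heis_dual_reg :: ('n, 'd) heis_dual set"
  have "Ck_on k (\<lambda>p. ((1/2) *\<^sub>R (Ji ** transpose (fst p) ** matrix_inv (mat_of (snd p)) ** fst p), fst p, snd p)) ?U"
    for k
    by (intro Ck_on_Pair Ck_on_linear_compose[OF bounded_linear_scaleR_right] Ck_on_const
        Ck_on_bilinear[OF bounded_bilinear_matrix_mult] Ck_on_matrix_inv
        Ck_on_linear_compose[OF bounded_linear_transpose] Ck_on_linear_compose[OF bounded_linear_mat_of]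
        Ck_on_bounded_linear bounded_linear_fst bounded_linear_snd open_heis_dual_reg)
       (auto simp: heis_dual_reg_def)
  moreover have "Psi J = (\<lambda>p :: ('n, 'd) heis_dual.
      ((1/2) *\<^sub>R (Ji ** transpose (fst p) ** matrix_inv (mat_of (snd p)) ** fst p), fst p, snd p))"
    by (simp add: fun_eq_iff)
  ultimately show ?thesis by (simp add: smooth_on_def)
qed

text \<open>Smoothness of \<open>Psi\<close> supplies a derivative on the whole space; its values on
  \<open>(\<delta>, 0)\<close> are then identified by restricting to the slice of constant
  \<open>M\<close>, where the pairing is an explicit quadratic polynomial in
  \<open>K\<close>.\<close>

lemma partial_K_jac_pairing_Psi:
  fixes A :: "real^('d::finite)^'n"
  assumes S: "S \<in> sp J" and M: "det (mat_of M) \<noteq> 0"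
  shows "partial_K (\<lambda>q. jac_pairing (Psi J q) (S, A, B)) (K, M) =
    S ** (Ji ** (transpose K ** matrix_inv (mat_of M))) + A"
proof -
  let ?N = "matrix_inv (mat_of M)"
  let ?P = "Psi J :: ('n, 'd) heis_dual \<Rightarrow> _"
  let ?h = "\<lambda>q. jac_pairing (?P q) (S, A, B)"
  have "?P differentiable at (K, M)"
    using smooth_on_has_derivative[OF smooth_on_Psi, of "(K, M)"] M
    by (auto simp: heis_dual_reg_def intro: differentiableI)
  then obtain P' where P': "(?P has_derivative P') (at (K, M))"
    unfolding differentiable_def by blast
  have lin: "bounded_linear (\<lambda>\<mu>. jac_pairing \<mu> (S, A, B))"
    unfolding linear_conv_bounded_linear[symmetric]
    by (rule linearI) (auto simp: matrix_linear algebra_simps)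
  have h': "(?h has_derivative (\<lambda>v. jac_pairing (P' v) (S, A, B))) (at (K, M))"
    by (rule bounded_linear.has_derivative[OF lin P'])
  have curve: "((\<lambda>X. (X, M)) has_derivative (\<lambda>\<delta>. (\<delta>, 0))) (at K)"
    by (intro has_derivative_Pair has_derivative_ident has_derivative_const)
  have 1: "((\<lambda>X. ?h (X, M)) has_derivative (\<lambda>\<delta>. jac_pairing (P' (\<delta>, 0)) (S, A, B))) (at K)"
    using diff_chain_at[OF curve h'] by (simp add: o_def)
  have q: "((\<lambda>X. transpose X ** (?N ** X)) has_derivative
      (\<lambda>\<delta>. transpose K ** (?N ** \<delta>) + transpose \<delta> ** (?N ** K))) (at K)"
    by (intro matrix_mult.FDERIV bounded_linear_imp_has_derivative bounded_linear_transpose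
        matrix_mult.bounded_linear_right)
  have "bounded_linear (\<lambda>Y. 1/2 * trace (Ji ** (Y ** S)))"
    unfolding linear_conv_bounded_linear[symmetric]
    by (rule linearI) (simp_all add: matrix_linear algebra_simps)
  from bounded_linear.has_derivative[OF this q]
  have "((\<lambda>X. 1/2 * trace (Ji ** (transpose X ** (?N ** X) ** S))) has_derivative
      (\<lambda>\<delta>. 1/2 * trace (Ji ** ((transpose K ** (?N ** \<delta>) + transpose \<delta> ** (?N ** K)) ** S)))) (at K)" .
  moreover have "bounded_linear (\<lambda>X :: real^'n^'d. trace (X ** A))"
    unfolding linear_conv_bounded_linear[symmetric]
    by (rule linearI) (simp_all add: matrix_linear)
  ultimately have "((\<lambda>X. 1/2 * trace (Ji ** (transpose X ** (?N ** X) ** S)) + trace (X ** A) + trace (mat_of M ** mat_of B))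
      has_derivative (\<lambda>\<delta>. 1/2 * trace (Ji ** ((transpose K ** (?N ** \<delta>) + transpose \<delta> ** (?N ** K)) ** S))
        + trace (\<delta> ** A) + 0)) (at K)"
    by (intro has_derivative_add bounded_linear_imp_has_derivative has_derivative_const)
  moreover have "(\<lambda>X. ?h (X, M)) = (\<lambda>X. 1/2 * trace (Ji ** (transpose X ** (?N ** X) ** S))
      + trace (X ** A) + trace (mat_of M ** mat_of B))"
    by (simp add: matrix_linear matrix_mul_assoc fun_eq_iff)
  ultimately have 2: "((\<lambda>X. ?h (X, M)) has_derivative
      (\<lambda>\<delta>. 1/2 * trace (Ji ** ((transpose K ** (?N ** \<delta>) + transpose \<delta> ** (?N ** K)) ** S))
        + trace (\<delta> ** A) + 0)) (at K)"
    by (simp only:)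
  \<comment> \<open>The two halves of the product rule have equal trace because \<open>S\<close>
    lies in \<open>sp J\<close>; together they cancel the factor 1/2.\<close>
  have swap: "trace (Ji ** (transpose \<delta> ** (?N ** K) ** S)) = trace (S ** (Ji ** (transpose K ** (?N ** \<delta>))))" for \<delta>
  proof -
    have "Ji ** transpose S = - (S ** Ji)"
    proof -
      have "Ji ** (transpose S ** J) ** Ji = - (S ** Ji)"
        by (simp add: spD[OF S] matrix_linear J_Ji matrix_mul_assoc[symmetric])
      then show ?thesis by (simp add: J_Ji matrix_mul_assoc[symmetric])
    qed
    then have JS: "Ji ** (transpose S ** X) = - (S ** (Ji ** X))" for X :: "real^'n^'n"
      by (simp add: matrix_mul_assoc matrix_mult.minus_left)
    have "trace (Ji ** (transpose \<delta> ** (?N ** K) ** S)) =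
        trace (transpose (Ji ** (transpose \<delta> ** (?N ** K) ** S)))"
      by (simp only: trace_transpose)
    also have "\<dots> = - trace (transpose S ** (transpose K ** (?N ** \<delta>)) ** Ji)"
      by (simp add: matrix_transpose_mul transpose_Ji transpose_inv_mat_of[OF M] matrix_linear
          matrix_mul_assoc[symmetric])
    also have "\<dots> = - trace (Ji ** (transpose S ** (transpose K ** (?N ** \<delta>))))"
      by (simp add: trace_mul_sym[of _ Ji])
    finally show ?thesis by (simp add: JS matrix_linear)
  qed
  have cyc: "trace (Ji ** (transpose K ** (?N ** \<delta>) ** S)) = trace (S ** (Ji ** (transpose K ** (?N ** \<delta>))))" for \<delta>
    using trace_mul_sym[of S "Ji ** (transpose K ** (?N ** \<delta>))"] by (simp add: matrix_mul_assoc)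
  have "(\<lambda>\<delta>. jac_pairing (P' (\<delta>, 0)) (S, A, B)) =
      (\<lambda>\<delta>. 1/2 * trace (Ji ** ((transpose K ** (?N ** \<delta>) + transpose \<delta> ** (?N ** K)) ** S))
        + trace (\<delta> ** A) + 0)"
    by (rule has_derivative_unique[OF 1 2])
  then have "jac_pairing (P' (\<delta>, 0)) (S, A, B) =
      trace (S ** (Ji ** (transpose K ** (?N ** \<delta>)))) + trace (\<delta> ** A)" for \<delta>
    by (simp add: fun_eq_iff matrix_mult.add_left matrix_mult.add_right trace_add swap cyc)
  then show ?thesis
    by (intro partial_K_eqI[OF h'])
       (simp add: matrix_mult.add_left trace_add matrix_mul_assoc trace_mul_sym[of A])
qed

text \<open>In the bracket the gradient of the Hamiltonian meets \<open>M\<close>, which cancels the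
  inverse in \<open>Psi\<close> and leaves minus the generator. The second minus sign arises when
  the trace is transposed, as \<open>J\<close> is antisymmetric; hence the plus bracket.\<close>

lemma momentum_identity:
  fixes f :: "('n, 'd::finite) heis_dual \<Rightarrow> real"
  assumes f: "(f has_derivative f') (at (K, M))"
    and \<xi>: "(S, A, B) \<in> jac_algebra J" and M: "det (mat_of M) \<noteq> 0"
  shows "lie_poisson 1 J f (\<lambda>q. jac_pairing (Psi J q) (S, A, B)) (K, M) =
    f' (jac_generator J (S, A, B) (K, M))"
proof -
  let ?F = "partial_K f (K, M)" and ?M = "mat_of M" and ?N = "matrix_inv (mat_of M)"
  let ?D = "S ** (Ji ** (transpose K ** ?N)) + A"
  have S: "S \<in> sp J" using \<xi> by (simp add: jac_algebra_def)
  have NM: "?N ** ?M = mat 1" "?M ** (?N ** X) = X" for X :: "real^'n^'d"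
    using M by (simp_all add: matrix_mul_assoc matrix_inv_inverse invertible_det_nz)
  have D: "?M ** (transpose ?D ** J) = K ** S + ?M ** (transpose A ** J)"
    by (simp add: matrix_transpose_mul transpose_inv_mat_of[OF M] matrix_linear
        matrix_mul_assoc[symmetric] transpose_Ji spD[OF S] J_Ji NM)
  have "trace (?M ** transpose ?F ** J ** ?D) = trace (transpose (?M ** transpose ?F ** J ** ?D))"
    by (simp only: trace_transpose)
  also have "\<dots> = - trace (transpose ?D ** (J ** (?F ** ?M)))"
    unfolding matrix_transpose_mul
    by (simp add: transpose_J matrix_mult_linear linear_neg[OF bounded_linear_trace[THEN bounded_linear.linear]])
  also have "trace (transpose ?D ** (J ** (?F ** ?M))) = trace (?F ** (?M ** (transpose ?D ** J)))"
    using trace_mul_sym[of "transpose ?D ** J" "?F ** ?M"] by (simp only: matrix_mul_assoc)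
  finally have "lie_poisson 1 J f (\<lambda>q. jac_pairing (Psi J q) (S, A, B)) (K, M) =
      trace (?F ** (- (K ** S) - ?M ** (transpose A ** J)))"
    unfolding D lie_poisson_def partial_K_jac_pairing_Psi[OF S M]
    by (simp add: matrix_linear)
  then show ?thesis
    by (simp add: jac_generator_eq[OF \<xi>] partial_K_works[OF f])
qed

lemma is_momentum_map_Psi:
  "is_momentum_map (lie_poisson 1 J) J (heis_dual_reg :: ('n, 'd::finite) heis_dual set) (Psi J)"
  unfolding is_momentum_map_def
proof (intro conjI ballI allI impI)
  show "smooth_on heis_dual_reg (Psi J :: ('n, 'd) heis_dual \<Rightarrow> _)"
    by (rule smooth_on_Psi)
  show "Psi J ` heis_dual_reg \<subseteq> (jac_dual_space J :: ('n, 'd) jac_dual set)"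
    using Psi_in_jac_dual_space by blast
  fix \<xi> :: "('n, 'd) jac" and f :: "('n, 'd) heis_dual \<Rightarrow> real"
    and p :: "('n, 'd) heis_dual"
  assume \<xi>: "\<xi> \<in> jac_algebra J" and f: "smooth_on heis_dual_reg f" and p: "p \<in> heis_dual_reg"
  obtain S A B where \<xi>_eq: "\<xi> = (S, A, B)" by (cases \<xi>)
  obtain K M where p_eq: "p = (K, M)" by (cases p)
  show "lie_poisson 1 J f (\<lambda>q. jac_pairing (Psi J q) \<xi>) p =
      frechet_derivative f (at p) (jac_generator J \<xi> p)"
    unfolding \<xi>_eq p_eq
    by (rule momentum_identity)
       (use smooth_on_has_derivative[OF f p] \<xi> p in \<open>simp_all add: \<xi>_eq p_eq heis_dual_reg_def\<close>)
qed

end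

theorem proposition2p9:
  fixes J :: "real^'n^'n" and k :: nat
  assumes "CARD('n) = 2 * k"
    and "invertible J"
    and "transpose J = - J"
  shows "group_action (Jac J :: ('n, 'd::finite) jac monoid) UNIV (jac_action J)
    \<and> (\<forall>\<sigma>\<in>{1, -1}. \<forall>a\<in>carrier (Jac J :: ('n, 'd) jac monoid).
         poisson_map (lie_poisson \<sigma> J) UNIV (jac_action J a))
    \<and> open (heis_dual_reg :: ('n, 'd) heis_dual set)
    \<and> (\<forall>a\<in>carrier (Jac J :: ('n, 'd) jac monoid).
         jac_action J a ` heis_dual_reg \<subseteq> heis_dual_reg)
    \<and> is_momentum_map (lie_poisson 1 J) J (heis_dual_reg :: ('n, 'd) heis_dual set) (Psi J)
    \<and> is_equivariant J (heis_dual_reg :: ('n, 'd) heis_dual set) (Psi J)"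
proof -
  interpret symplectic_form J
    by standard (use assms in auto)
  have "jac_action J a ` heis_dual_reg \<subseteq> heis_dual_reg" for a :: "('n, 'd) jac"
    by (cases a) (auto simp: heis_dual_reg_def)
  then show ?thesis
    by (intro conjI ballI group_action_Jac poisson_map_jac_action open_heis_dual_reg
        is_momentum_map_Psi is_equivariant_Psi)
qed

end
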